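(* For every pure inner function $\Theta:\mathbb{D}\to\mathcal{L}(\mathbb{C}^N)$, the map $\tau^\Theta:X\to\mathfrak{K}$, $\Omega\mapsto\overline{W(U^\Theta_\Omega)}$, wraps $\overline{W(S_\Theta)}$.
   Context: A bounded analytic $\Theta:\mathbb{D}\to\mathcal{L}(\mathbb{C}^N)$ is inner if its radial boundary values are isometries a.e. on $\mathbb{T}$, and pure if $\|\Theta(0)x\|<\|x\|$ for $x\neq0$. $K_\Theta=H^2(\mathbb{C}^N)\ominus\Theta H^2(\mathbb{C}^N)$, $S_\Theta=P_{K_\Theta}\mathbf{T}_z|_{K_\Theta}$ with $\mathbf{T}_z$ multiplication by $z$ on $H^2(\mathbb{C}^N)$. $D_A=(I-A^*A)^{1/2}$. Define $\iota,\iota_*:\mathbb{C}^N\to K_\Theta$ by $\iota(D_{\Theta(0)}\xi)=\frac1z(\Theta(z)-\Theta(0))\xi$, $\iota_*(D_{\Theta(0)^*}\xi)=(I-\Theta(z)\Theta(0)^* )\xi$ (isometries onto $\mathcal{D}_{S_\Theta}$ and $\mathcal{D}_{S_\Theta^*}$). $X$ is the set of unitary operators on $\mathbb{C}^N$, and for $\Omega\in X$, $U^\Theta_\Omega=\begin{pmatrix} S_\Theta & \iota_*D_{\Theta(0)^*}\Omega\\ D_{\Theta(0)}\iota^* & \Theta(0)^*\Omega\end{pmatrix}$ on $K_\Theta\oplus\mathbb{C}^N$ (a unitary $N$-dilation of $S_\Theta$). $W$ denotes numerical range. $\mathfrak{K}$ is the space of nonempty compact subsets of $\mathbb{C}$ with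 the Hausdorff distance; a continuous $\tau:X\to\mathfrak{K}$ wraps $A\in\mathfrak{K}$ if for each open half-plane $\mathbb{H}\supset A$ there exists $x\in X$ with $\tau(x)\subset\mathbb{H}$. *)

theory Defs
  imports "HOL-Analysis.Analysis"
begin

definition cinner :: "complex^'n::finite \<Rightarrow> complex^'n \<Rightarrow> complex" where
  "cinner x y = (\<Sum>i\<in>UNIV. x $ i * cnj (y $ i))"

definition cscale :: "complex \<Rightarrow> complex^'n::finite \<Rightarrow> complex^'n" where
  "cscale c v = (\<chi> i. c * v $ i)"

definition adj :: "complex^'n::finite^'n \<Rightarrow> complex^'n^'n" where
  "adj A = (\<chi> i j. cnj (A $ j $ i))"

definition psd :: "complex^'n::finite^'n \<Rightarrow> bool" where
  "psd B \<longleftrightarrow> (\<forall>x. Im (cinner (B *v x) x) = 0 \<and> Re (cinner (B *v x) x) \<ge> 0)"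

definition defect :: "complex^'n::finite^'n \<Rightarrow> complex^'n^'n" where
  "defect A = (THE B. psd B \<and> B ** B = mat 1 - adj A ** A)"

definition unitary :: "complex^'n::finite^'n \<Rightarrow> bool" where
  "unitary U \<longleftrightarrow> adj U ** U = mat 1"

definition bounded_analytic :: "(complex \<Rightarrow> complex^'n::finite^'n) \<Rightarrow> bool" where
  "bounded_analytic \<Theta> \<longleftrightarrow>
     (\<forall>i j. (\<lambda>z. \<Theta> z $ i $ j) holomorphic_on ball 0 1) \<and> bounded (\<Theta> ` ball 0 1)"

definition isometry_mat :: "complex^'n::finite^'n \<Rightarrow> bool" where
  "isometry_mat L \<longleftrightarrow> (\<forall>x. norm (L *v x) = norm x)"

definition inner_fun :: "(complex \<Rightarrow> complex^'n::finite^'n) \<Rightarrow> bool" where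
  "inner_fun \<Theta> \<longleftrightarrow> bounded_analytic \<Theta> \<and>
     (AE t in lebesgue_on {0..2*pi}.
        \<exists>L. ((\<lambda>r. \<Theta> (complex_of_real r * cis t)) \<longlongrightarrow> L) (at_left 1) \<and> isometry_mat L)"

definition pure_fun :: "(complex \<Rightarrow> complex^'n::finite^'n) \<Rightarrow> bool" where
  "pure_fun \<Theta> \<longleftrightarrow> (\<forall>x. x \<noteq> 0 \<longrightarrow> norm (\<Theta> 0 *v x) < norm x)"

text \<open>Elements of H^2(C^N) are represented as functions on the disc (set to 0 off the
  open unit disc, so that they are uniquely determined), holomorphic on the disc, whose
  Taylor coefficients at 0 are square summable; the inner product is the l^2 inner product
  of the Taylor coefficients.\<close>

definition hcoeff :: "(complex \<Rightarrow> complex^'n::finite) \<Rightarrow> nat \<Rightarrow> complex^'n" where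
  "hcoeff f k = (\<chi> i. (deriv ^^ k) (\<lambda>z. f z $ i) 0 / fact k)"

definition H2 :: "(complex \<Rightarrow> complex^'n::finite) set" where
  "H2 = {f. (\<forall>i. (\<lambda>z. f z $ i) holomorphic_on ball 0 1) \<and> (\<forall>z. z \<notin> ball 0 1 \<longrightarrow> f z = 0)
            \<and> summable (\<lambda>k. (norm (hcoeff f k))\<^sup>2)}"

definition h2inner :: "(complex \<Rightarrow> complex^'n::finite) \<Rightarrow> (complex \<Rightarrow> complex^'n) \<Rightarrow> complex" where
  "h2inner f g = (\<Sum>k. cinner (hcoeff f k) (hcoeff g k))"

definition shiftz :: "(complex \<Rightarrow> complex^'n::finite) \<Rightarrow> (complex \<Rightarrow> complex^'n)" where
  "shiftz f = (\<lambda>z. cscale z (f z))"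

definition multop :: "(complex \<Rightarrow> complex^'n::finite^'n) \<Rightarrow> (complex \<Rightarrow> complex^'n) \<Rightarrow> (complex \<Rightarrow> complex^'n)" where
  "multop \<Theta> g = (\<lambda>z. \<Theta> z *v g z)"

definition KTheta :: "(complex \<Rightarrow> complex^'n::finite^'n) \<Rightarrow> (complex \<Rightarrow> complex^'n) set" where
  "KTheta \<Theta> = {f \<in> H2. \<forall>g\<in>H2. h2inner f (multop \<Theta> g) = 0}"

definition projK :: "(complex \<Rightarrow> complex^'n::finite^'n) \<Rightarrow> (complex \<Rightarrow> complex^'n) \<Rightarrow> (complex \<Rightarrow> complex^'n)" where
  "projK \<Theta> h = (THE g. g \<in> KTheta \<Theta> \<and> (\<forall>k\<in>KTheta \<Theta>. h2inner (\<lambda>z. h z - g z) k = 0))"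

definition STheta :: "(complex \<Rightarrow> complex^'n::finite^'n) \<Rightarrow> (complex \<Rightarrow> complex^'n) \<Rightarrow> (complex \<Rightarrow> complex^'n)" where
  "STheta \<Theta> f = projK \<Theta> (shiftz f)"

text \<open>Theta'(0), the value at 0 of (Theta(z) - Theta(0))/z.\<close>
definition dTheta0 :: "(complex \<Rightarrow> complex^'n::finite^'n) \<Rightarrow> complex^'n^'n" where
  "dTheta0 \<Theta> = (\<chi> i j. deriv (\<lambda>z. \<Theta> z $ i $ j) 0)"

definition iota :: "(complex \<Rightarrow> complex^'n::finite^'n) \<Rightarrow> complex^'n \<Rightarrow> (complex \<Rightarrow> complex^'n)" where
  "iota \<Theta> \<eta> = (let \<xi> = (THE \<xi>. defect (\<Theta> 0) *v \<xi> = \<eta>) in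
      (\<lambda>z. if z \<in> ball 0 1 then
              (if z = 0 then dTheta0 \<Theta> *v \<xi> else cscale (1 / z) ((\<Theta> z - \<Theta> 0) *v \<xi>))
            else 0))"

definition iota_star :: "(complex \<Rightarrow> complex^'n::finite^'n) \<Rightarrow> complex^'n \<Rightarrow> (complex \<Rightarrow> complex^'n)" where
  "iota_star \<Theta> \<eta> = (let \<xi> = (THE \<xi>. defect (adj (\<Theta> 0)) *v \<xi> = \<eta>) in
      (\<lambda>z. if z \<in> ball 0 1 then \<xi> - \<Theta> z *v (adj (\<Theta> 0) *v \<xi>) else 0))"

definition iota_adj :: "(complex \<Rightarrow> complex^'n::finite^'n) \<Rightarrow> (complex \<Rightarrow> complex^'n) \<Rightarrow> complex^'n" where
  "iota_adj \<Theta> f = (THE v. \<forall>\<eta>. cinner v \<eta> = h2inner f (iota \<Theta> \<eta>))"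

definition UOmega :: "(complex \<Rightarrow> complex^'n::finite^'n) \<Rightarrow> complex^'n^'n
     \<Rightarrow> (complex \<Rightarrow> complex^'n) \<times> (complex^'n) \<Rightarrow> (complex \<Rightarrow> complex^'n) \<times> (complex^'n)" where
  "UOmega \<Theta> \<Omega> p = (case p of (f, v) \<Rightarrow>
     ((\<lambda>z. STheta \<Theta> f z + iota_star \<Theta> (defect (adj (\<Theta> 0)) *v (\<Omega> *v v)) z),
      defect (\<Theta> 0) *v iota_adj \<Theta> f + adj (\<Theta> 0) *v (\<Omega> *v v)))"

definition sum_inner :: "(complex \<Rightarrow> complex^'n::finite) \<times> (complex^'n)
     \<Rightarrow> (complex \<Rightarrow> complex^'n) \<times> (complex^'n) \<Rightarrow> complex" where
  "sum_inner p q = h2inner (fst p) (fst q) + cinner (snd p) (snd q)"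

definition numrange_S :: "(complex \<Rightarrow> complex^'n::finite^'n) \<Rightarrow> complex set" where
  "numrange_S \<Theta> = {h2inner (STheta \<Theta> f) f | f. f \<in> KTheta \<Theta> \<and> h2inner f f = 1}"

definition numrange_U :: "(complex \<Rightarrow> complex^'n::finite^'n) \<Rightarrow> complex^'n^'n \<Rightarrow> complex set" where
  "numrange_U \<Theta> \<Omega> = {sum_inner (UOmega \<Theta> \<Omega> p) p | p.
        fst p \<in> KTheta \<Theta> \<and> sum_inner p p = 1}"

definition hausdorff_dist :: "complex set \<Rightarrow> complex set \<Rightarrow> real" where
  "hausdorff_dist A B = max (SUP a\<in>A. infdist a B) (SUP b\<in>B. infdist b A)"

definition open_halfplane :: "complex set \<Rightarrow> bool" where
  "open_halfplane H \<longleftrightarrow> (\<exists>a c. a \<noteq> 0 \<and> H = {z. Re (cnj a * z) < c})"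

definition wraps :: "'x::metric_space set \<Rightarrow> ('x \<Rightarrow> complex set) \<Rightarrow> complex set \<Rightarrow> bool" where
  "wraps X \<tau> A \<longleftrightarrow>
     (\<forall>x\<in>X. compact (\<tau> x) \<and> \<tau> x \<noteq> {}) \<and>
     (\<forall>x\<in>X. \<forall>e>0. \<exists>d>0. \<forall>y\<in>X. dist y x < d \<longrightarrow> hausdorff_dist (\<tau> y) (\<tau> x) < e) \<and>
     (\<forall>H. open_halfplane H \<and> A \<subseteq> H \<longrightarrow> (\<exists>x\<in>X. \<tau> x \<subseteq> H))"

end

(*
  The dilation acts on K_Theta + Theta C^N, the orthogonal complement of z Theta H^2, by
  f + Theta v |-> z f + Omega v, and it is isometric there. Let |u| = 1 and
  c' = sup Re (conj u * W(S_Theta)) < c <= 1. Choose b on the unit circle such that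
  c' < Re (conj u * b) < c and Theta has an isometric radial limit L at b, and put Omega = b L.
  Formally every v in C^N then extends to an eigenvector E = e + Theta v of the dilation with
  eigenvalue b, so each g = f + Theta v is k + E with k in K_Theta, and
    <U g, g> = <z k, k> + b (|g|^2 - |k|^2),
  because the cross terms b <E, k> + <U k, E> add up to b times a real number. Taking real parts
  gives Re (conj u * <U g, g>) <= Re (conj u * b) |g|^2. Rigorously, b is approached by b / r with
  r -> 1-, where e is the explicit kernel (w - Theta(z) Theta(r b)^* w) / (b / r - z), w = Omega v;
  e stays bounded since Re (conj u * (b / r - S_Theta)) is bounded below.
*)
theory Submission
  imports Defs "HOL-Complex_Analysis.Laurent_Convergence"
begin

section \<open>Matrices and defect operators\<close>

text \<open>The kernel and the choice of \<open>\<Omega>\<close> come from the eigenvalue equation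
  \<open>z e + w = b (e + \<Theta> v)\<close> with \<open>w = \<Omega> v\<close>. It forces
  \<open>e = (w - b \<Theta> v) / (b - z)\<close>, and for \<open>\<Omega> = b L\<close> one has
  \<open>b v = adj L w\<close>, so \<open>e\<close> is up to a scalar the reproducing kernel of the
  model space at the boundary point \<open>b\<close>. Such a kernel is not known in advance to lie
  in H^2, hence the interior points \<mu> = r b, whose reflection is \<zeta> = 1 / cnj \<mu> = b /
  r. The kernels are not shown to converge as r tends to 1. A bound on their norms suffices, because
  the eigenvalue equation then fails only by \<open>(\<zeta> - b) e + \<Theta> (d - b v)\<close>
  with \<open>d = adj (\<Theta> (r b)) w\<close>, which tends to 0 in norm.

  A second obstacle is that \<open>inner_fun\<close> speaks of radial limits but
  \<open>h2inner\<close> of Taylor coefficients. Parseval on circles of radius r < 1 connects them: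
  multiplication by \<Theta> is isometric on polynomials, which have boundary values everywhere, and
  then on H^2 by density.\<close>

lemma cinner_add_left: "cinner (x + y) z = cinner x z + cinner y z"
  and cinner_add_right: "cinner z (x + y) = cinner z x + cinner z y"
  and cinner_diff_left: "cinner (x - y) z = cinner x z - cinner y z"
  by (simp_all add: cinner_def algebra_simps sum.distrib sum_subtractf)

lemma cinner_cscale_left: "cinner (cscale c x) y = c * cinner x y"
  and cinner_cscale_right: "cinner x (cscale c y) = cnj c * cinner x y"
  by (simp_all add: cinner_def cscale_def sum_distrib_left mult_ac)

lemma cinner_zero [simp]: "cinner 0 x = 0" "cinner x 0 = 0"
  by (simp_all add: cinner_def)

lemma cinner_commute: "cinner y x = cnj (cinner x y)"
  by (simp add: cinner_def mult.commute)

lemma norm_vec_sq: "(norm (x :: 'a::real_normed_vector ^ 'n::finite))\<^sup>2 = (\<Sum>i\<in>UNIV. (norm (x $ i))\<^sup>2)"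
  by (simp add: norm_vec_def L2_set_def sum_nonneg)

lemma cinner_self: "cinner x x = complex_of_real ((norm x)\<^sup>2)"
  by (simp add: cinner_def norm_vec_sq complex_norm_square[symmetric])

lemma norm_cscale: "norm (cscale c x) = norm c * norm x"
proof -
  have "(norm (cscale c x))\<^sup>2 = (norm c * norm x)\<^sup>2"
    by (simp add: norm_vec_sq cscale_def norm_mult power_mult_distrib sum_distrib_left)
  thus ?thesis by (simp add: power2_eq_iff_nonneg)
qed

lemma norm_cinner_le: "norm (cinner x y) \<le> norm x * norm y"
proof -
  have "norm (cinner x y) \<le> (\<Sum>i\<in>UNIV. \<bar>norm (x $ i)\<bar> * \<bar>norm (y $ i)\<bar>)"
    unfolding cinner_def by (rule order_trans[OF norm_sum]) (simp add: norm_mult)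
  also have "\<dots> \<le> norm x * norm y"
    unfolding norm_vec_def by (rule L2_set_mult_ineq)
  finally show ?thesis .
qed

lemma cinner_adj: "cinner (A *v x) y = cinner x (adj A *v y)"
  unfolding cinner_def adj_def matrix_vector_mult_def
  by (simp add: sum_distrib_left sum_distrib_right) (subst sum.swap, simp add: mult_ac)

lemma adj_adj [simp]: "adj (adj A) = A"
  by (simp add: adj_def vec_eq_iff)

lemma cinner_adj': "cinner x (A *v y) = cinner (adj A *v x) y"
  by (simp add: cinner_adj)

lemma adj_mult: "adj (A ** B) = adj B ** adj A"
  by (simp add: adj_def matrix_matrix_mult_def vec_eq_iff mult.commute)

lemma adj_add: "adj (A + B) = adj A + adj B"
  and adj_diff: "adj (A - B) = adj A - adj B"
  and adj_one [simp]: "adj (mat 1) = mat 1"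
  by (auto simp: adj_def vec_eq_iff mat_def)

lemma adj_scaleR: "adj (r *\<^sub>R A) = r *\<^sub>R adj A"
  by (simp add: adj_def vec_eq_iff complex_eq_iff)

lemma matrix_vector_mult_cscale: "A *v cscale c x = cscale c (A *v x)"
  by (simp add: matrix_vector_mult_def cscale_def vec_eq_iff sum_distrib_left mult_ac)

lemma complex_matrix_scaleR:
  fixes A :: "complex^'n::finite^'m::finite"
  shows "(r *\<^sub>R A) *v x = r *\<^sub>R (A *v x)" "A *v (r *\<^sub>R x) = r *\<^sub>R (A *v x)"
  by (simp_all add: matrix_vector_mult_def vec_eq_iff scaleR_sum_right)

lemma cscale_right_distrib: "cscale c (x + y) = cscale c x + cscale c y"
  and cscale_right_diff: "cscale c (x - y) = cscale c x - cscale c y"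
  and cscale_left_diff: "cscale (c - d) x = cscale c x - cscale d x"
  and cscale_cscale: "cscale c (cscale d x) = cscale (c * d) x"
  and cscale_one [simp]: "cscale 1 x = x"
  and cscale_zero [simp]: "cscale c 0 = 0" "cscale 0 x = 0"
  by (simp_all add: cscale_def vec_eq_iff algebra_simps)

lemma cinner_eq_0_imp:
  assumes "\<And>y. cinner x y = 0"
  shows "x = 0"
  using assms[of x] by (simp add: cinner_self)

text \<open>Polarization over the complex numbers: the vectors \<open>x + y\<close> and
  \<open>x + \<i> y\<close> yield the sum and the difference of the two mixed terms, so both
  vanish.\<close>

lemma matrix_eqI_cinner:
  assumes "\<And>x. cinner (A *v x) x = cinner (B *v x) x"
  shows "A = B"
proof -
  define C where "C = A - B"
  have q: "cinner (C *v x) x = 0" for x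
    using assms[of x] by (simp add: C_def matrix_vector_mult_diff_rdistrib cinner_diff_left)
  have "cinner (C *v x) y = 0" for x y
  proof -
    have 1: "cinner (C *v x) y + cinner (C *v y) x = 0"
      using q[of "x + y"] q[of x] q[of y]
      by (simp add: matrix_vector_right_distrib cinner_add_left cinner_add_right) (simp add: add.commute)
    have 2: "cinner (C *v x) y - cinner (C *v y) x = 0"
      using q[of "x + cscale \<i> y"] q[of x] q[of y]
      by (simp add: matrix_vector_right_distrib cinner_add_left cinner_add_right
          matrix_vector_mult_cscale cinner_cscale_left cinner_cscale_right algebra_simps)
    from 1 2 have "2 * cinner (C *v x) y = 0"
      by (metis add_diff_cancel_right' add_eq_0_iff diff_0 eq_iff_diff_eq_0 minus_add_cancel mult_2 diff_minus_eq_add)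
    thus ?thesis by simp
  qed
  hence "C *v x = 0" for x by (blast intro: cinner_eq_0_imp)
  hence "C = 0" by (simp add: matrix_eq)
  thus ?thesis by (simp add: C_def)
qed

text \<open>\<open>psd\<close> only asks for a real nonnegative form. A real form is the same for
  \<open>B\<close> and \<open>adj B\<close>, and polarization then identifies the two.\<close>

lemma psd_adj:
  assumes "psd B" shows "adj B = B"
proof (rule matrix_eqI_cinner)
  fix x
  have "cinner (adj B *v x) x = cnj (cinner (B *v x) x)"
    by (metis cinner_adj cinner_commute)
  also have "\<dots> = cinner (B *v x) x"
    using assms by (simp add: psd_def complex_eq_iff)
  finally show "cinner (adj B *v x) x = cinner (B *v x) x" .
qed

lemma isometry_mat_adj_mult:
  assumes "isometry_mat L" shows "adj L ** L = mat 1"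
proof (rule matrix_eqI_cinner)
  fix x
  have "cinner (L *v x) (L *v x) = cinner x x"
    using assms by (simp add: cinner_self isometry_mat_def)
  thus "cinner ((adj L ** L) *v x) x = cinner (mat 1 *v x) x"
    by (simp add: cinner_adj' matrix_vector_mul_assoc)
qed

text \<open>The norm that the matrix type carries is the Hilbert-Schmidt norm. It dominates the
  operator norm by Cauchy-Schwarz in each row.\<close>

lemma norm_mat_vec_le: "norm (A *v x) \<le> norm (A :: complex^'n::finite^'n) * norm x"
proof -
  have 1: "(norm ((A *v x) $ i))\<^sup>2 \<le> (norm (A $ i))\<^sup>2 * (norm x)\<^sup>2" for i
  proof -
    have "(A *v x) $ i = cinner (A $ i) (\<chi> j. cnj (x $ j))"
      by (simp add: matrix_vector_mult_def cinner_def)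
    moreover have "norm (\<chi> j. cnj (x $ j)) = norm x"
      by (simp add: norm_vec_def)
    ultimately have "norm ((A *v x) $ i) \<le> norm (A $ i) * norm x"
      using norm_cinner_le[of "A $ i" "\<chi> j. cnj (x $ j)"] by simp
    thus ?thesis by (metis norm_ge_zero power_mono power_mult_distrib)
  qed
  have "(norm (A *v x))\<^sup>2 \<le> (norm A * norm x)\<^sup>2"
    unfolding norm_vec_sq[of "A *v x"] norm_vec_sq[of A] power_mult_distrib sum_distrib_right
    by (rule sum_mono) (rule 1)
  thus ?thesis by (rule power2_le_imp_le) simp
qed

lemma norm_adj: "norm (adj A) = norm A"
proof -
  have "(norm (adj A))\<^sup>2 = (norm A)\<^sup>2"
    unfolding norm_vec_sq by (subst sum.swap) (simp add: adj_def)
  thus ?thesis by (simp add: power2_eq_iff_nonneg)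
qed

lemma norm_mat_sq_columns: "(norm (A :: complex^'n::finite^'n))\<^sup>2 = (\<Sum>j\<in>UNIV. (norm (column j A))\<^sup>2)"
  unfolding norm_vec_sq by (subst sum.swap) (simp add: column_def)

text \<open>Mixes an operator bound for the left factor with the Hilbert-Schmidt norm of the right
  one, column by column. This makes the fixed point map below a contraction for the metric of the
  type.\<close>

lemma norm_matrix_mult_le:
  fixes A B :: "complex^'n::finite^'n"
  assumes "\<And>x. norm (A *v x) \<le> \<rho> * norm x" and "\<rho> \<ge> 0"
  shows "norm (A ** B) \<le> \<rho> * norm B"
proof -
  have "column j (A ** B) = A *v column j B" for j
    by (simp add: column_def matrix_matrix_mult_def matrix_vector_mult_def)
  hence "(norm (A ** B))\<^sup>2 \<le> (\<Sum>j\<in>UNIV. (\<rho> * norm (column j B))\<^sup>2)"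
    unfolding norm_mat_sq_columns by (intro sum_mono) (simp add: assms(1) power_mono)
  also have "\<dots> = (\<rho> * norm B)\<^sup>2"
    by (simp add: power_mult_distrib norm_mat_sq_columns sum_distrib_left)
  finally show ?thesis by (rule power2_le_imp_le) (simp add: assms(2))
qed

lemma norm_adj_mult_vec_le:
  assumes "\<And>x. norm (A *v x) \<le> q * norm x"
  shows "norm (adj A *v x) \<le> q * norm x"
proof (cases "adj A *v x = 0")
  case False
  have "(norm (adj A *v x))\<^sup>2 = norm (cinner (A *v (adj A *v x)) x)"
    by (simp add: cinner_adj cinner_self norm_power)
  also have "\<dots> \<le> norm (A *v (adj A *v x)) * norm x" by (rule norm_cinner_le)
  also have "\<dots> \<le> q * norm (adj A *v x) * norm x"
    by (intro mult_right_mono assms) simp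
  finally have "norm (adj A *v x) * norm (adj A *v x) \<le> norm (adj A *v x) * (q * norm x)"
    by (simp add: power2_eq_square mult_ac)
  thus ?thesis using False by simp
next
  case True
  then show ?thesis using order_trans[OF norm_ge_zero assms, of x] by simp
qed

text \<open>Compactness of the unit sphere turns the pointwise strict inequality into a uniform
  one.\<close>

lemma strict_contraction_bound:
  fixes A :: "complex^'n::finite^'n"
  assumes "\<And>x. x \<noteq> 0 \<Longrightarrow> norm (A *v x) < norm x"
  obtains q where "0 \<le> q" "q < 1" "\<And>x. norm (A *v x) \<le> q * norm x"
proof -
  have "continuous_on (sphere 0 1) (\<lambda>x. norm (A *v x))"
    by (intro continuous_intros)
  moreover have "axis undefined 1 \<in> sphere (0 :: complex^'n) 1"
    by (simp add: norm_axis_1)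
  hence "sphere (0 :: complex^'n) 1 \<noteq> {}" by blast
  ultimately obtain x0 where x0: "norm x0 = 1" "\<And>x. norm x = 1 \<Longrightarrow> norm (A *v x) \<le> norm (A *v x0)"
    using continuous_attains_sup[of "sphere (0 :: complex^'n) 1" "\<lambda>x. norm (A *v x)"] by auto
  show ?thesis
  proof (rule that[of "norm (A *v x0)"])
    show "norm (A *v x0) < 1" using assms[of x0] x0(1) by force
    fix x show "norm (A *v x) \<le> norm (A *v x0) * norm x"
    proof (cases "x = 0")
      case False
      have "norm (A *v ((1 / norm x) *\<^sub>R x)) \<le> norm (A *v x0)"
        using False by (intro x0(2)) simp
      also have "A *v ((1 / norm x) *\<^sub>R x) = (1 / norm x) *\<^sub>R (A *v x)"
        by (rule complex_matrix_scaleR)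
      finally show ?thesis using False by (simp add: field_simps)
    qed simp
  qed simp
qed

lemma mat_mult_diff_distribs:
  fixes A B C :: "complex^'n::finite^'n"
  shows "A ** (B - C) = A ** B - A ** C" "(B - C) ** A = B ** A - C ** A"
  by (simp_all add: matrix_matrix_mult_def vec_eq_iff algebra_simps sum_subtractf)

lemma mat_mult_add_distribs:
  fixes A B C :: "complex^'n::finite^'n"
  shows "A ** (B + C) = A ** B + A ** C" "(B + C) ** A = B ** A + C ** A"
  by (simp_all add: matrix_matrix_mult_def vec_eq_iff algebra_simps sum.distrib)

text \<open>Writing the square root as \<open>1 - Y\<close> turns the equation into the fixed point problem
  \<open>Y = (X + Y\<^sup>2) / 2\<close>, which is a contraction on the ball of radius \<open>1 - sqrt (1 - q)\<close>.\<close>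

lemma ex_sqrt_one_minus:
  fixes X :: "complex^'n::finite^'n"
  assumes X: "\<And>x. norm (X *v x) \<le> q * norm x" "adj X = X" and q: "0 \<le> q" "q < 1"
  obtains B \<epsilon> where "adj B = B" "\<epsilon> > 0" "\<And>x. Re (cinner (B *v x) x) \<ge> \<epsilon> * (norm x)\<^sup>2"
    "B ** B = mat 1 - X"
proof -
  define \<rho> where "\<rho> = 1 - sqrt (1 - q)"
  have \<rho>: "0 \<le> \<rho>" "\<rho> < 1" "(q + \<rho> * \<rho>) / 2 = \<rho>"
  proof -
    have "\<rho> * \<rho> = 1 - 2 * sqrt (1 - q) + (sqrt (1 - q))\<^sup>2"
      by (simp add: \<rho>_def power2_eq_square algebra_simps)
    thus "(q + \<rho> * \<rho>) / 2 = \<rho>" using q by (simp add: \<rho>_def)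
  qed (use q in \<open>auto simp: \<rho>_def\<close>)
  \<comment> \<open>The ball is measured in the operator norm, while \<open>dist\<close> is the
    Hilbert-Schmidt distance. Being a fixed point of \<open>(q + \<rho>\<^sup>2) / 2\<close>, the
    radius \<open>\<rho>\<close> makes \<open>F\<close> preserve the ball, and it is also the
    contraction constant.\<close>
  define S where "S = {Y :: complex^'n^'n. adj Y = Y \<and> (\<forall>x. norm (Y *v x) \<le> \<rho> * norm x)}"
  define F where "F Y = (1/2) *\<^sub>R (X + Y ** Y)" for Y
  have "closed S"
  proof -
    have "continuous_on UNIV (\<lambda>Y :: complex^'n^'n. adj Y)"
      unfolding adj_def by (intro continuous_intros)
    moreover have "continuous_on UNIV (\<lambda>Y :: complex^'n^'n. Y *v x)" for x
      unfolding matrix_vector_mult_def by (intro continuous_intros)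
    ultimately show ?thesis
      unfolding S_def by (intro closed_Collect_conj closed_Collect_eq closed_Collect_all
          closed_Collect_le continuous_intros) auto
  qed
  have "\<exists>!Y\<in>S. F Y = Y"
  proof (rule Banach_fix)
    show "complete S" using \<open>closed S\<close> by (simp add: complete_eq_closed)
    have "0 \<in> S" using \<rho> by (simp add: S_def adj_def vec_eq_iff)
    thus "S \<noteq> {}" by blast
    show "F ` S \<subseteq> S"
    proof
      fix Z assume "Z \<in> F ` S"
      then obtain Y where Y: "Y \<in> S" "Z = F Y" by blast
      have "norm (Z *v x) \<le> \<rho> * norm x" for x
      proof -
        have "norm (Z *v x) = (1/2) * norm (X *v x + Y *v (Y *v x))"
          by (simp add: Y F_def matrix_vector_mul_assoc matrix_vector_mult_add_rdistrib
              complex_matrix_scaleR)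
        also have "\<dots> \<le> (1/2) * (q * norm x + \<rho> * (\<rho> * norm x))"
        proof -
          have "norm (Y *v (Y *v x)) \<le> \<rho> * norm (Y *v x)" using Y by (simp add: S_def)
          also have "\<dots> \<le> \<rho> * (\<rho> * norm x)" using Y \<rho> by (intro mult_left_mono) (auto simp: S_def)
          finally show ?thesis using X(1)[of x] norm_triangle_ineq[of "X *v x" "Y *v (Y *v x)"] by simp
        qed
        also have "\<dots> = (q + \<rho> * \<rho>) / 2 * norm x" by (simp add: algebra_simps)
        finally show ?thesis using \<rho> by simp
      qed
      moreover have "adj Z = Z"
        using Y X(2) by (simp add: F_def S_def adj_scaleR adj_add adj_mult)
      ultimately show "Z \<in> S" by (simp add: S_def)
    qed
    fix Y Z assume YZ: "Y \<in> S" "Z \<in> S"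
    have 1: "norm (Y ** (Y - Z)) \<le> \<rho> * norm (Y - Z)"
      using YZ \<rho> by (intro norm_matrix_mult_le) (auto simp: S_def)
    \<comment> \<open>Taking adjoints brings the factor with the operator bound to the left, where
      \<open>norm_matrix_mult_le\<close> applies.\<close>
    have "norm ((Y - Z) ** Z) = norm (Z ** (Y - Z))"
      using norm_adj[of "(Y - Z) ** Z"] YZ by (simp add: adj_mult adj_diff S_def)
    also have "\<dots> \<le> \<rho> * norm (Y - Z)"
      using YZ \<rho> by (intro norm_matrix_mult_le) (auto simp: S_def)
    finally have 2: "norm ((Y - Z) ** Z) \<le> \<rho> * norm (Y - Z)" .
    have "F Y - F Z = (1/2) *\<^sub>R (Y ** (Y - Z) + (Y - Z) ** Z)"
      by (simp add: F_def mat_mult_diff_distribs algebra_simps)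
    hence "norm (F Y - F Z) \<le> (1/2) * (norm (Y ** (Y - Z)) + norm ((Y - Z) ** Z))"
      using norm_triangle_ineq[of "Y ** (Y - Z)" "(Y - Z) ** Z"] by simp
    thus "dist (F Y) (F Z) \<le> \<rho> * dist Y Z" using 1 2 by (simp add: dist_norm)
  qed (use \<rho> in auto)
  then obtain Y where Y: "Y \<in> S" "F Y = Y" by blast
  show ?thesis
  proof (rule that[of "mat 1 - Y" "1 - \<rho>"])
    show "adj (mat 1 - Y) = mat 1 - Y" using Y by (simp add: adj_diff S_def)
    show "1 - \<rho> > 0" using \<rho> by simp
    fix x
    have "Re (cinner (Y *v x) x) \<le> norm (Y *v x) * norm x"
      using order_trans[OF complex_Re_le_cmod norm_cinner_le] .
    also have "\<dots> \<le> \<rho> * norm x * norm x" using Y by (intro mult_right_mono) (auto simp: S_def)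
    finally show "Re (cinner ((mat 1 - Y) *v x) x) \<ge> (1 - \<rho>) * (norm x)\<^sup>2"
      by (simp add: matrix_vector_mult_diff_rdistrib cinner_diff_left cinner_self power2_eq_square algebra_simps)
  next
    have "Y + Y = X + Y ** Y"
      using arg_cong[OF Y(2), of "\<lambda>Z. 2 *\<^sub>R Z"] by (simp add: F_def scaleR_2)
    hence "Y ** Y = Y + Y - X" by simp
    thus "(mat 1 - Y) ** (mat 1 - Y) = mat 1 - X"
      by (simp add: mat_mult_diff_distribs)
  qed
qed

text \<open>If \<open>B\<^sup>2 = C\<^sup>2\<close> then \<open>D = B - C\<close> anticommutes with \<open>S = B + C\<close>, so \<open>tr (D S D) = 0\<close> by cyclicity,
  while \<open>S\<close> is positive definite.\<close>

lemma sqrt_unique: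
  fixes B C :: "complex^'n::finite^'n"
  assumes B: "adj B = B" "\<epsilon> > 0" "\<And>x. Re (cinner (B *v x) x) \<ge> \<epsilon> * (norm x)\<^sup>2"
    and C: "psd C" "C ** C = B ** B"
  shows "C = B"
proof -
  define D S where "D = B - C" and "S = B + C"
  have hC: "adj C = C" by (rule psd_adj[OF C(1)])
  have hD: "adj D = D" by (simp add: D_def adj_diff B hC)
  have anti: "S ** D + D ** S = 0"
    by (simp add: S_def D_def mat_mult_diff_distribs mat_mult_add_distribs C(2))
  have "D ** (S ** D) + D ** (D ** S) = 0"
    unfolding mat_mult_add_distribs(1)[symmetric] anti by (simp add: matrix_matrix_mult_def vec_eq_iff)
  hence "trace (D ** (S ** D) + D ** (D ** S)) = 0"
    by (simp add: trace_def)
  hence "trace (D ** (S ** D)) + trace (D ** (D ** S)) = 0"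
    by (simp only: trace_add)
  moreover have "trace (D ** (D ** S)) = trace (D ** (S ** D))"
    by (metis trace_mul_sym matrix_mul_assoc)
  ultimately have tr: "trace (D ** (S ** D)) = 0" by simp
  have "trace (D ** (S ** D)) = (\<Sum>i\<in>UNIV. cinner (S *v (D *v axis i 1)) (D *v axis i 1))"
  proof -
    have "cinner (S *v (D *v axis i 1)) (D *v axis i 1) = (D ** (S ** D)) $ i $ i" for i
    proof -
      have "cinner (S *v (D *v axis i 1)) (D *v axis i 1) = cinner ((D ** (S ** D)) *v axis i 1) (axis i 1)"
        by (simp add: cinner_adj' hD matrix_vector_mul_assoc)
      also have "\<dots> = (D ** (S ** D)) $ i $ i"
        by (simp add: cinner_def axis_def matrix_vector_mult_def if_distrib cong: if_cong)
      finally show ?thesis .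
    qed
    thus ?thesis by (simp add: trace_def)
  qed
  hence s0: "(\<Sum>i\<in>UNIV. Re (cinner (S *v (D *v axis i 1)) (D *v axis i 1))) = 0"
    using tr by (metis Re_sum zero_complex.sel(1))
  \<comment> \<open>\<open>C\<close> is only positive semidefinite, but the sum inherits the strict
    lower bound of \<open>B\<close>.\<close>
  have pos: "Re (cinner (S *v x) x) \<ge> \<epsilon> * (norm x)\<^sup>2" for x
    using B(3)[of x] C(1) by (simp add: S_def psd_def matrix_vector_mult_add_rdistrib cinner_add_left add_increasing2)
  have nn: "Re (cinner (S *v x) x) \<ge> 0" for x
    using order_trans[OF _ pos] B(2) by simp
  have "Re (cinner (S *v (D *v axis i 1)) (D *v axis i 1)) = 0" for i
    using s0 nn by (subst (asm) sum_nonneg_eq_0_iff) auto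
  hence "\<epsilon> * (norm (D *v axis i 1))\<^sup>2 \<le> 0" for i by (metis pos)
  hence "D *v axis i 1 = 0" for i
    using B(2) by (metis mult_le_0_iff norm_eq_zero not_le power2_less_eq_zero_iff)
  hence "D = 0"
    by (simp add: vec_eq_iff axis_def matrix_vector_mult_def if_distrib cong: if_cong)
  thus ?thesis by (simp add: D_def)
qed

section \<open>Defect operators of strict contractions\<close>

context
  fixes A :: "complex^'n::finite^'n"
  assumes contr: "\<And>x. x \<noteq> 0 \<Longrightarrow> norm (A *v x) < norm x"
begin

text \<open>Shows that the description in \<open>defect\<close> denotes: the root exists because
  \<open>adj A ** A\<close> has operator bound \<open>q\<^sup>2 < 1\<close>, and it is unique
  because the constructed root is bounded below by \<epsilon>.\<close>

lemma defect_props: "psd (defect A)" "defect A ** defect A = mat 1 - adj A ** A"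
proof -
  obtain q where q: "0 \<le> q" "q < 1" "\<And>x. norm (A *v x) \<le> q * norm x"
    using strict_contraction_bound[OF contr] by blast
  have "norm ((adj A ** A) *v x) \<le> q\<^sup>2 * norm x" for x
  proof -
    have "norm (adj A *v (A *v x)) \<le> q * norm (A *v x)" by (rule norm_adj_mult_vec_le[OF q(3)])
    also have "\<dots> \<le> q * (q * norm x)" by (intro mult_left_mono q)
    finally show ?thesis by (simp add: matrix_vector_mul_assoc power2_eq_square mult_ac)
  qed
  moreover have "adj (adj A ** A) = adj A ** A" by (simp add: adj_mult)
  moreover have "q\<^sup>2 < 1" using q by (simp add: power_less_one_iff)
  ultimately obtain B \<epsilon> where B: "adj B = B" "\<epsilon> > 0" "\<And>x. Re (cinner (B *v x) x) \<ge> \<epsilon> * (norm x)\<^sup>2"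
    "B ** B = mat 1 - adj A ** A"
    using ex_sqrt_one_minus[of "adj A ** A" "q\<^sup>2"] by auto
  have "psd B"
    unfolding psd_def
  proof safe
    fix x
    have "cnj (cinner (B *v x) x) = cinner (B *v x) x"
      by (metis B(1) cinner_adj cinner_commute)
    thus "Im (cinner (B *v x) x) = 0" by (simp add: complex_eq_iff)
    show "0 \<le> Re (cinner (B *v x) x)" using order_trans[OF _ B(3)] B(2) by simp
  qed
  hence "\<exists>!B. psd B \<and> B ** B = mat 1 - adj A ** A"
    using B sqrt_unique[OF B(1-3)] by metis
  from theI'[OF this] show "psd (defect A)" "defect A ** defect A = mat 1 - adj A ** A"
    by (simp_all add: defect_def)
qed

lemma adj_defect: "adj (defect A) = defect A"
  by (rule psd_adj[OF defect_props(1)])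

lemma strict_contraction_adj:
  assumes "x \<noteq> 0" shows "norm (adj A *v x) < norm x"
proof -
  obtain q where q: "0 \<le> q" "q < 1" "\<And>x. norm (A *v x) \<le> q * norm x"
    using strict_contraction_bound[OF contr] by blast
  have "norm (adj A *v x) \<le> q * norm x" by (rule norm_adj_mult_vec_le[OF q(3)])
  also have "\<dots> < norm x" using q assms by simp
  finally show ?thesis .
qed

text \<open>On the kernel of \<open>mat 1 - adj A ** A\<close> the matrix \<open>A\<close> would
  preserve norms, against strictness. Together with \<open>defect_surj\<close> this gives a value to
  the descriptions in \<open>iota\<close> and \<open>iota_star\<close>, which divide by the defect
  operator.\<close>

lemma defect_inj: "defect A *v x = defect A *v y \<longleftrightarrow> x = y"
proof
  assume "defect A *v x = defect A *v y"
  hence "(defect A ** defect A) *v (x - y) = 0"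
    by (simp add: matrix_vector_mult_diff_distrib flip: matrix_vector_mul_assoc)
  hence "x - y = adj A *v (A *v (x - y))"
    by (simp add: defect_props matrix_vector_mult_diff_rdistrib matrix_vector_mul_assoc)
  hence "cinner (x - y) (x - y) = cinner (A *v (x - y)) (A *v (x - y))"
    by (metis cinner_adj)
  hence "norm (x - y) = norm (A *v (x - y))"
    unfolding cinner_self by (simp add: power2_eq_iff_nonneg del: of_real_power)
  thus "x = y" using contr[of "x - y"] by force
qed simp

lemma defect_surj: "\<exists>x. defect A *v x = y"
proof -
  have "inj ((*v) (defect A))" by (rule injI) (simp add: defect_inj)
  then obtain B where "B ** defect A = mat 1"
    using matrix_left_invertible_injective by blast
  hence "defect A ** B = mat 1" by (simp add: matrix_left_right_inverse)
  hence "defect A *v (B *v y) = y" by (simp add: matrix_vector_mul_assoc)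
  thus ?thesis ..
qed

end

section \<open>Parseval on circles\<close>

abbreviation circ_measure :: "real measure" where
  "circ_measure \<equiv> lebesgue_on {0..2*pi}"

lemma integral_cis_of_int:
  "integral\<^sup>L circ_measure (\<lambda>t. cis (of_int m * t)) = (if m = 0 then 2 * of_real pi else 0)"
proof -
  have cont: "continuous_on {0..2*pi} (\<lambda>t. cis (of_int m * t))"
    by (intro continuous_intros)
  have eq: "integral\<^sup>L circ_measure (\<lambda>t. cis (of_int m * t)) = integral {0..2*pi} (\<lambda>t. cis (of_int m * t))"
    by (rule lebesgue_integral_eq_integral[OF continuous_imp_integrable_real[OF cont]]) simp
  show ?thesis
  proof (cases "m = 0")
    case True
    hence "integral {0..2*pi} (\<lambda>t. cis (of_int m * t)) = 2 * of_real pi"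
      by (simp add: scaleR_conv_of_real)
    thus ?thesis unfolding eq using True by (simp only: if_True simp_thms)
  next
    case False
    have "((\<lambda>t. cis (of_int m * t)) has_integral
        (cis (of_int m * (2*pi)) / (\<i> * of_int m) - cis (of_int m * 0) / (\<i> * of_int m))) {0..2*pi}"
    proof (rule fundamental_theorem_of_calculus)
      fix x :: real
      have "((\<lambda>t. exp (\<i> * of_int m * complex_of_real t) / (\<i> * of_int m)) has_vector_derivative
          exp (\<i> * of_int m * complex_of_real x)) (at x within {0..2*pi})"
        using False
        by (auto intro!: derivative_eq_intros has_vector_derivative_real_field)
      thus "((\<lambda>t. cis (of_int m * t) / (\<i> * of_int m)) has_vector_derivative cis (of_int m * x))
          (at x within {0..2*pi})"
        by (simp add: cis_conv_exp mult_ac)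
    qed simp
    moreover have "cis (of_int m * (2*pi)) = 1"
      using cis_multiple_2pi[of "of_int m"] by (simp add: mult_ac)
    ultimately show ?thesis
      using False by (simp add: eq integral_unique)
  qed
qed

lemma integral_norm_trig_poly_sq:
  "integral\<^sup>L circ_measure (\<lambda>t. (norm (\<Sum>k<n. c k * cis (real k * t)))\<^sup>2) = 2 * pi * (\<Sum>k<n. (norm (c k))\<^sup>2)"
proof -
  have "complex_of_real (integral\<^sup>L circ_measure (\<lambda>t. (norm (\<Sum>k<n. c k * cis (real k * t)))\<^sup>2))
      = integral\<^sup>L circ_measure (\<lambda>t. complex_of_real ((norm (\<Sum>k<n. c k * cis (real k * t)))\<^sup>2))"
    by (rule integral_complex_of_real[symmetric])
  also have "(\<lambda>t. complex_of_real ((norm (\<Sum>k<n. c k * cis (real k * t)))\<^sup>2)) =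
      (\<lambda>t. \<Sum>j<n. \<Sum>k<n. c j * cnj (c k) * cis (of_int (int j - int k) * t))"
  proof
    fix t
    have "cis (real j * t) * cis (- (real k * t)) = cis (of_int (int j - int k) * t)" for j k
      by (simp add: cis_mult algebra_simps)
    thus "complex_of_real ((norm (\<Sum>k<n. c k * cis (real k * t)))\<^sup>2) =
        (\<Sum>j<n. \<Sum>k<n. c j * cnj (c k) * cis (of_int (int j - int k) * t))"
      unfolding complex_norm_square
      by (simp add: sum_product cis_cnj mult_ac del: of_int_diff)
  qed
  also have "integral\<^sup>L circ_measure \<dots> = (\<Sum>j<n. \<Sum>k<n. c j * cnj (c k) * (if int j - int k = 0 then 2 * of_real pi else 0))"
  proof -
    have int: "integrable circ_measure (\<lambda>t. c j * cnj (c k) * cis (of_int (int j - int k) * t))" for j k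
      by (intro continuous_imp_integrable_real continuous_intros)
    show ?thesis
      by (subst Bochner_Integration.integral_sum, use int in force)
         (subst Bochner_Integration.integral_sum[OF int],
          simp add: integral_cis_of_int del: of_int_diff)
  qed
  also have "\<dots> = (\<Sum>j<n. c j * cnj (c j) * (2 * of_real pi))"
    by (intro sum.cong refl) (simp add: if_distrib cong: if_cong)
  also have "\<dots> = complex_of_real (2 * pi * (\<Sum>k<n. (norm (c k))\<^sup>2))"
    by (simp add: complex_norm_square sum_distrib_left mult_ac del: of_real_power)
  finally show ?thesis by (simp only: of_real_eq_iff)
qed

text \<open>Orthogonality settles trigonometric polynomials. Absolute summability bounds all partial
  sums by one constant, so dominated convergence carries the identity to the series.\<close>

lemma parseval_abs_summable:
  fixes c :: "nat \<Rightarrow> complex"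
  assumes c: "summable (\<lambda>k. norm (c k))"
  shows "(\<lambda>k. (norm (c k))\<^sup>2) sums
      (integral\<^sup>L circ_measure (\<lambda>t. (norm (\<Sum>k. c k * cis (real k * t)))\<^sup>2) / (2 * pi))"
proof -
  have summ: "summable (\<lambda>k. c k * cis (real k * t))" for t
    by (rule summable_norm_cancel) (simp add: norm_mult c)
  define C where "C = (\<Sum>k. norm (c k))"
  have le: "norm (\<Sum>k<n. c k * cis (real k * t)) \<le> C" for n t
    unfolding C_def by (rule order_trans[OF norm_sum])
      (simp add: norm_mult sum_le_suminf[OF c])
  have "(\<lambda>n. integral\<^sup>L circ_measure (\<lambda>t. (norm (\<Sum>k<n. c k * cis (real k * t)))\<^sup>2)) \<longlonglongrightarrow>
      integral\<^sup>L circ_measure (\<lambda>t. (norm (\<Sum>k. c k * cis (real k * t)))\<^sup>2)"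
  proof (rule integral_dominated_convergence[where w = "\<lambda>_. C\<^sup>2"])
    show meas: "(\<lambda>t. (norm (\<Sum>k<n. c k * cis (real k * t)))\<^sup>2) \<in> borel_measurable circ_measure" for n
      by (intro continuous_imp_measurable_on_sets_lebesgue continuous_intros) simp
    show "(\<lambda>t. (norm (\<Sum>k. c k * cis (real k * t)))\<^sup>2) \<in> borel_measurable circ_measure"
    proof (rule borel_measurable_LIMSEQ_real[OF _ meas])
      show "(\<lambda>n. (norm (\<Sum>k<n. c k * cis (real k * t)))\<^sup>2) \<longlonglongrightarrow> (norm (\<Sum>k. c k * cis (real k * t)))\<^sup>2" for t
        by (intro tendsto_intros summable_LIMSEQ summ)
    qed
    show "AE t in circ_measure. (\<lambda>n. (norm (\<Sum>k<n. c k * cis (real k * t)))\<^sup>2) \<longlonglongrightarrow> (norm (\<Sum>k. c k * cis (real k * t)))\<^sup>2"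
      by (intro AE_I2 tendsto_intros summable_LIMSEQ summ)
    show "AE t in circ_measure. norm ((norm (\<Sum>k<n. c k * cis (real k * t)))\<^sup>2) \<le> C\<^sup>2" for n
      by (intro AE_I2) (simp add: power_mono le)
  qed simp
  hence "(\<lambda>n. 2 * pi * (\<Sum>k<n. (norm (c k))\<^sup>2)) \<longlonglongrightarrow>
      integral\<^sup>L circ_measure (\<lambda>t. (norm (\<Sum>k. c k * cis (real k * t)))\<^sup>2)"
    by (simp only: integral_norm_trig_poly_sq)
  from tendsto_divide[OF this tendsto_const[of "2 * pi"]] show ?thesis
    by (simp add: sums_def)
qed

section \<open>Taylor coefficients and mean squares of vector-valued holomorphic functions\<close>

definition hol_vec :: "(complex \<Rightarrow> complex^'n::finite) \<Rightarrow> bool" where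
  "hol_vec f \<longleftrightarrow> (\<forall>i. (\<lambda>z. f z $ i) holomorphic_on ball 0 1)"

lemma hol_vec_sums:
  assumes "hol_vec f" "norm z < 1"
  shows "(\<lambda>k. hcoeff f k $ i * z ^ k) sums (f z $ i)"
proof -
  have "(\<lambda>z. f z $ i) holomorphic_on ball 0 1" using assms by (simp add: hol_vec_def)
  from holomorphic_power_series[OF this, of z] assms(2) show ?thesis
    by (simp add: hcoeff_def)
qed

lemma hol_vec_abs_summable:
  assumes "hol_vec f" "0 \<le> r" "r < 1"
  shows "summable (\<lambda>k. norm (hcoeff f k $ i * complex_of_real r ^ k))"
proof -
  define s where "s = (r + 1) / 2"
  have s: "r < s" "s < 1" "0 < s" using assms by (auto simp: s_def)
  have "summable (\<lambda>k. hcoeff f k $ i * complex_of_real s ^ k)"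
    using hol_vec_sums[OF assms(1), of "of_real s" i] s by (simp add: sums_iff)
  from powser_insidea[OF this, of "of_real r"] show ?thesis using s assms by simp
qed

lemma hol_vec_continuous:
  assumes "hol_vec f" "A \<subseteq> ball 0 1"
  shows "continuous_on A f"
proof -
  have "continuous_on A (\<lambda>z. \<chi> i. f z $ i)"
    using assms by (intro continuous_on_vec_lambda holomorphic_on_imp_continuous_on)
      (auto simp: hol_vec_def intro: holomorphic_on_subset)
  thus ?thesis by simp
qed

lemma hol_vec_continuous_circle:
  assumes "hol_vec f" "0 \<le> r" "r < 1"
  shows "continuous_on A (\<lambda>t. f (complex_of_real r * cis t))"
  using assms(2,3)
  by (intro continuous_on_compose2[OF hol_vec_continuous[OF assms(1) subset_refl]] continuous_intros)
     (auto simp: norm_mult)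

text \<open>On the circle of radius \<open>r\<close> the Fourier coefficients are the Taylor
  coefficients times \<open>r ^ k\<close>. For \<open>r < 1\<close> they are absolutely summable
  whatever the behaviour at the boundary.\<close>

lemma parseval_circle:
  assumes f: "hol_vec f" and r: "0 \<le> r" "r < 1"
  shows "(\<lambda>k. (norm (hcoeff f k))\<^sup>2 * (r\<^sup>2) ^ k) sums
      (integral\<^sup>L circ_measure (\<lambda>t. (norm (f (complex_of_real r * cis t)))\<^sup>2) / (2 * pi))"
proof -
  have 1: "(\<lambda>k. (norm (hcoeff f k $ i))\<^sup>2 * (r\<^sup>2) ^ k) sums
      (integral\<^sup>L circ_measure (\<lambda>t. (norm (f (complex_of_real r * cis t) $ i))\<^sup>2) / (2 * pi))" for i
  proof -
    have "(\<Sum>k. hcoeff f k $ i * complex_of_real r ^ k * cis (real k * t)) = f (complex_of_real r * cis t) $ i" for t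
    proof -
      have "(\<lambda>k. hcoeff f k $ i * (complex_of_real r * cis t) ^ k) sums (f (complex_of_real r * cis t) $ i)"
        using r by (intro hol_vec_sums f) (simp add: norm_mult)
      thus ?thesis by (simp add: power_mult_distrib Complex.DeMoivre sums_iff mult_ac)
    qed
    moreover have "(norm (hcoeff f k $ i * complex_of_real r ^ k))\<^sup>2 = (norm (hcoeff f k $ i))\<^sup>2 * (r\<^sup>2) ^ k" for k
      using r by (simp add: norm_mult norm_power power_mult_distrib flip: power_mult) (simp add: mult.commute)
    ultimately show ?thesis
      using parseval_abs_summable[OF hol_vec_abs_summable[OF f r, of i]] by simp
  qed
  have int: "integrable circ_measure (\<lambda>t. (norm (f (complex_of_real r * cis t) $ i))\<^sup>2)" for i
    by (intro continuous_imp_integrable_real continuous_intros hol_vec_continuous_circle f r)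
  have "integral\<^sup>L circ_measure (\<lambda>t. (norm (f (complex_of_real r * cis t)))\<^sup>2) / (2 * pi)
     = (\<Sum>i\<in>UNIV. integral\<^sup>L circ_measure (\<lambda>t. (norm (f (complex_of_real r * cis t) $ i))\<^sup>2) / (2 * pi))"
    unfolding norm_vec_sq by (subst Bochner_Integration.integral_sum[OF int]) (simp add: sum_divide_distrib)
  moreover have "(\<lambda>k. (norm (hcoeff f k))\<^sup>2 * (r\<^sup>2) ^ k) = (\<lambda>k. \<Sum>i\<in>UNIV. (norm (hcoeff f k $ i))\<^sup>2 * (r\<^sup>2) ^ k)"
    by (simp add: norm_vec_sq sum_distrib_right)
  ultimately show ?thesis using sums_sum[of UNIV, OF 1] by simp
qed

section \<open>Abel summation along radii tending to 1\<close>

definition radii :: "nat \<Rightarrow> real" where "radii n = 1 - inverse (real (Suc n))"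

lemma radii_bounds: "0 \<le> radii n" "radii n < 1"
  by (auto simp: radii_def field_simps)

text \<open>Turns the limits along \<open>at_left 1\<close> in \<open>inner_fun\<close> into limits
  of sequences, the form in which dominated convergence is used.\<close>

lemma radii_at_left: "filterlim radii (at_left 1) sequentially"
proof -
  have "(\<lambda>n. 1 - inverse (real (Suc n))) \<longlonglongrightarrow> 1 - 0"
    by (intro tendsto_intros LIMSEQ_inverse_real_of_nat)
  hence "radii \<longlonglongrightarrow> 1" by (simp add: radii_def[abs_def])
  thus ?thesis
    unfolding filterlim_at using radii_bounds(2) by (auto simp: less_imp_neq)
qed

lemma radii_LIMSEQ: "radii \<longlonglongrightarrow> 1"
  using radii_at_left by (simp add: filterlim_at)

lemma sums_le_partial:
  fixes a :: "nat \<Rightarrow> real"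
  assumes "\<And>k. a k \<ge> 0" "a sums s"
  shows "sum a {..<m} \<le> s"
  using sum_le_suminf[of a "{..<m}"] assms by (simp add: sums_iff)

text \<open>Each finite partial sum is the limit of its own Abel means, and since the terms are
  nonnegative these lie below the full Abel means.\<close>

lemma sums_of_abel_bound:
  fixes a :: "nat \<Rightarrow> real"
  assumes a: "\<And>k. a k \<ge> 0" and A: "\<And>n. (\<lambda>k. a k * ((radii n)\<^sup>2) ^ k) sums A n" "\<And>n. A n \<le> L"
  shows "summable a" "suminf a \<le> L"
proof -
  have *: "sum a {..<m} \<le> L" for m
  proof (rule LIMSEQ_le_const2)
    have "(\<lambda>n. \<Sum>k<m. a k * ((radii n)\<^sup>2) ^ k) \<longlonglongrightarrow> (\<Sum>k<m. a k * (1\<^sup>2) ^ k)"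
      by (intro tendsto_intros radii_LIMSEQ)
    thus "(\<lambda>n. \<Sum>k<m. a k * ((radii n)\<^sup>2) ^ k) \<longlonglongrightarrow> sum a {..<m}" by simp
    have "(\<Sum>k<m. a k * ((radii n)\<^sup>2) ^ k) \<le> A n" for n
      by (rule sums_le_partial[OF _ A(1)]) (simp add: a)
    thus "\<exists>N. \<forall>n\<ge>N. (\<Sum>k<m. a k * ((radii n)\<^sup>2) ^ k) \<le> L"
      using A(2) order_trans by blast
  qed
  show "summable a" by (rule summableI_nonneg_bounded[OF a *])
  thus "suminf a \<le> L" by (intro suminf_le_const *)
qed

text \<open>For nonnegative terms the Abel means also lie below the sum of the series, so their
  limit is squeezed onto it.\<close>

lemma sums_of_abel_limit:
  fixes a :: "nat \<Rightarrow> real"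
  assumes a: "\<And>k. a k \<ge> 0" and A: "\<And>n. (\<lambda>k. a k * ((radii n)\<^sup>2) ^ k) sums A n" "A \<longlonglongrightarrow> L"
  shows "a sums L"
proof -
  obtain K where K: "\<And>n. A n \<le> K"
    using convergent_imp_Bseq[of A] A(2) by (metis Bseq_def abs_le_D1 convergentI real_norm_def)
  have summ: "summable a" by (rule sums_of_abel_bound[OF a A(1) K])
  have AS: "A n \<le> suminf a" for n
  proof -
    have "a k * ((radii n)\<^sup>2) ^ k \<le> a k" for k
      using radii_bounds[of n] a[of k] by (intro mult_left_le) (auto simp: power_le_one)
    thus ?thesis by (rule sums_le[OF _ A(1) summable_sums[OF summ]])
  qed
  have "L \<le> suminf a" by (rule LIMSEQ_le_const2[OF A(2)]) (use AS in blast)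
  moreover have "suminf a \<le> L"
  proof (rule suminf_le_const[OF summ])
    fix m
    have "(\<Sum>k<m. a k * ((radii n)\<^sup>2) ^ k) \<le> A n" for n
      by (rule sums_le_partial[OF _ A(1)]) (simp add: a)
    moreover have "(\<lambda>n. \<Sum>k<m. a k * ((radii n)\<^sup>2) ^ k) \<longlonglongrightarrow> (\<Sum>k<m. a k * (1\<^sup>2) ^ k)"
      by (intro tendsto_intros radii_LIMSEQ)
    ultimately show "sum a {..<m} \<le> L"
      using LIMSEQ_le[OF _ A(2)] by simp
  qed
  ultimately show ?thesis using summ by (simp add: sums_iff)
qed

section \<open>The Hardy space\<close>

lemma hol_vec_expansion:
  assumes "hol_vec f"
  shows "(\<lambda>z. f z $ i) has_fps_expansion Abs_fps (\<lambda>k. hcoeff f k $ i)"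
proof -
  have "(\<lambda>z. f z $ i) analytic_on {0}"
    using assms by (auto simp: hol_vec_def analytic_at intro!: exI[of _ "ball 0 1"])
  from analytic_at_imp_has_fps_expansion_0[OF this] show ?thesis
    by (simp add: fps_expansion_def hcoeff_def)
qed

lemma hcoeff_eqI:
  fixes f :: "complex \<Rightarrow> complex^'n::finite"
  assumes "\<And>i. (\<lambda>z. f z $ i) has_fps_expansion F i"
  shows "hcoeff f k = (\<chi> i. fps_nth (F i) k)"
  by (simp add: hcoeff_def vec_eq_iff fps_nth_fps_expansion[OF assms])

lemma hcoeff_0: "hcoeff f 0 = f 0"
  by (simp add: hcoeff_def vec_eq_iff)

lemma hcoeff_add:
  assumes "hol_vec f" "hol_vec g"
  shows "hcoeff (\<lambda>z. f z + g z) k = hcoeff f k + hcoeff g k"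
  by (subst hcoeff_eqI[where f = "\<lambda>z. f z + g z"])
     (auto intro!: fps_expansion_intros hol_vec_expansion assms simp: vec_eq_iff)

lemma hcoeff_diff:
  assumes "hol_vec f" "hol_vec g"
  shows "hcoeff (\<lambda>z. f z - g z) k = hcoeff f k - hcoeff g k"
  by (subst hcoeff_eqI[where f = "\<lambda>z. f z - g z"])
     (auto intro!: fps_expansion_intros hol_vec_expansion assms simp: vec_eq_iff)

lemma hcoeff_cscale:
  assumes "hol_vec f"
  shows "hcoeff (\<lambda>z. cscale c (f z)) k = cscale c (hcoeff f k)"
  by (subst hcoeff_eqI[where f = "\<lambda>z. cscale c (f z)" and F = "\<lambda>i. fps_const c * Abs_fps (\<lambda>k. hcoeff f k $ i)"])
     (auto intro!: fps_expansion_intros hol_vec_expansion assms simp: vec_eq_iff cscale_def)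

lemma hcoeff_shiftz:
  assumes "hol_vec f"
  shows "hcoeff (shiftz f) k = (case k of 0 \<Rightarrow> 0 | Suc m \<Rightarrow> hcoeff f m)"
  by (subst hcoeff_eqI[where f = "shiftz f" and F = "\<lambda>i. fps_X * Abs_fps (\<lambda>k. hcoeff f k $ i)"])
     (auto intro!: fps_expansion_intros hol_vec_expansion assms
       simp: vec_eq_iff cscale_def shiftz_def split: nat.split)

text \<open>Members of \<open>H2\<close> vanish off the disc, so a constant has to be cut off to be
  one of them.\<close>

definition disc_const :: "complex^'n::finite \<Rightarrow> complex \<Rightarrow> complex^'n" where
  "disc_const v = (\<lambda>z. if z \<in> ball 0 1 then v else 0)"

lemma disc_const_0 [simp]: "disc_const v 0 = v"
  by (simp add: disc_const_def)

lemma hcoeff_disc_const: "hcoeff (disc_const v) k = (if k = 0 then v else 0)"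
proof -
  have "(\<lambda>z. disc_const v z $ i) has_fps_expansion fps_const (v $ i)" for i
  proof -
    have "eventually (\<lambda>z. z \<in> ball (0::complex) 1) (nhds 0)"
      by (rule eventually_nhds_in_open) auto
    hence "eventually (\<lambda>z. eval_fps (fps_const (v $ i)) z = disc_const v z $ i) (nhds 0)"
      by eventually_elim (simp add: disc_const_def)
    thus ?thesis by (simp add: has_fps_expansion_def)
  qed
  from hcoeff_eqI[of "disc_const v", OF this] show ?thesis by (simp add: vec_eq_iff)
qed

lemma hol_vec_add: "hol_vec f \<Longrightarrow> hol_vec g \<Longrightarrow> hol_vec (\<lambda>z. f z + g z)"
  and hol_vec_cscale: "hol_vec f \<Longrightarrow> hol_vec (\<lambda>z. cscale c (f z))"
  and hol_vec_shiftz: "hol_vec f \<Longrightarrow> hol_vec (shiftz f)"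
  by (auto simp: hol_vec_def cscale_def shiftz_def intro!: holomorphic_intros)

lemma hol_vec_disc_const: "hol_vec (disc_const v)"
  unfolding hol_vec_def
proof
  fix i
  show "(\<lambda>z. disc_const v z $ i) holomorphic_on ball 0 1"
    by (rule holomorphic_transform[of "\<lambda>_. v $ i"]) (auto simp: disc_const_def)
qed

lemma H2_iff: "f \<in> H2 \<longleftrightarrow> hol_vec f \<and> (\<forall>z. z \<notin> ball 0 1 \<longrightarrow> f z = 0) \<and> summable (\<lambda>k. (norm (hcoeff f k))\<^sup>2)"
  by (simp add: H2_def hol_vec_def)

lemma H2_hol_vec: "f \<in> H2 \<Longrightarrow> hol_vec f"
  by (simp add: H2_iff)

lemma norm_add_sq_le: "(norm (x + y))\<^sup>2 \<le> 2 * (norm x)\<^sup>2 + 2 * (norm (y :: 'a :: real_normed_vector))\<^sup>2"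
proof -
  have "(norm (x + y))\<^sup>2 \<le> (norm x + norm y)\<^sup>2" by (intro power_mono norm_triangle_ineq) simp
  also have "\<dots> \<le> 2 * (norm x)\<^sup>2 + 2 * (norm y)\<^sup>2"
    using sum_squares_bound[of "norm x" "norm y"] by (simp add: power2_sum)
  finally show ?thesis .
qed

lemma H2_cscale: assumes "f \<in> H2" shows "(\<lambda>z. cscale c (f z)) \<in> H2"
  using assms by (auto simp: H2_iff hcoeff_cscale hol_vec_cscale norm_cscale power_mult_distrib intro!: summable_mult)

lemma H2_add: assumes "f \<in> H2" "g \<in> H2" shows "(\<lambda>z. f z + g z) \<in> H2"
proof -
  have "summable (\<lambda>k. 2 * (norm (hcoeff f k))\<^sup>2 + 2 * (norm (hcoeff g k))\<^sup>2)"
    using assms by (intro summable_add summable_mult) (auto simp: H2_iff)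
  hence "summable (\<lambda>k. (norm (hcoeff f k + hcoeff g k))\<^sup>2)"
    by (rule summable_comparison_test') (simp add: norm_add_sq_le)
  thus ?thesis using assms by (auto simp: H2_iff hcoeff_add hol_vec_add)
qed

lemma H2_diff: assumes "f \<in> H2" "g \<in> H2" shows "(\<lambda>z. f z - g z) \<in> H2"
proof -
  have "(\<lambda>z. f z + cscale (-1) (g z)) \<in> H2" by (intro H2_add H2_cscale assms)
  also have "(\<lambda>z. f z + cscale (-1) (g z)) = (\<lambda>z. f z - g z)"
    by (simp add: cscale_def vec_eq_iff fun_eq_iff)
  finally show ?thesis .
qed

lemma H2_shiftz: assumes "f \<in> H2" shows "shiftz f \<in> H2"
proof -
  have "summable (\<lambda>k. (norm (hcoeff (shiftz f) (Suc k)))\<^sup>2)"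
    using assms by (simp add: H2_iff hcoeff_shiftz)
  hence "summable (\<lambda>k. (norm (hcoeff (shiftz f) k))\<^sup>2)"
    using summable_Suc_iff[of "\<lambda>k. (norm (hcoeff (shiftz f) k))\<^sup>2"] by simp
  thus ?thesis using assms hol_vec_shiftz[of f] unfolding H2_iff by (auto simp: shiftz_def)
qed

lemma H2_disc_const: "disc_const v \<in> H2"
proof -
  have "summable (\<lambda>k. (norm (hcoeff (disc_const v) k))\<^sup>2)"
    by (rule summable_finite[of "{0}"]) (auto simp: hcoeff_disc_const)
  thus ?thesis using hol_vec_disc_const[of v] unfolding H2_iff by (auto simp: disc_const_def)
qed

lemma H2_zero: "(\<lambda>z. 0) \<in> H2"
  using H2_disc_const[of 0] by (simp add: disc_const_def)

lemmas H2_intros = H2_add H2_diff H2_cscale H2_shiftz H2_disc_const H2_zero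

section \<open>The Hilbert space structure of H^2\<close>

definition hnorm :: "(complex \<Rightarrow> complex^'n::finite) \<Rightarrow> real" where
  "hnorm f = sqrt (\<Sum>k. (norm (hcoeff f k))\<^sup>2)"

lemma hnorm_sq:
  assumes "f \<in> H2" shows "(hnorm f)\<^sup>2 = (\<Sum>k. (norm (hcoeff f k))\<^sup>2)"
  using assms by (simp add: hnorm_def H2_iff suminf_nonneg)

lemma hnorm_nonneg: "f \<in> H2 \<Longrightarrow> hnorm f \<ge> 0"
  by (simp add: hnorm_def H2_iff suminf_nonneg)

lemma summable_cinner:
  assumes "f \<in> H2" "g \<in> H2"
  shows "summable (\<lambda>k. cinner (hcoeff f k) (hcoeff g k))"
proof (rule summable_comparison_test')
  show "summable (\<lambda>k. (norm (hcoeff f k))\<^sup>2 + (norm (hcoeff g k))\<^sup>2)"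
    using assms by (intro summable_add) (auto simp: H2_iff)
  fix k
  have "norm (cinner (hcoeff f k) (hcoeff g k)) \<le> norm (hcoeff f k) * norm (hcoeff g k)"
    by (rule norm_cinner_le)
  also have "\<dots> \<le> (norm (hcoeff f k))\<^sup>2 + (norm (hcoeff g k))\<^sup>2"
    using sum_squares_bound[of "norm (hcoeff f k)" "norm (hcoeff g k)"]
      mult_nonneg_nonneg[OF norm_ge_zero[of "hcoeff f k"] norm_ge_zero[of "hcoeff g k"]]
    by linarith
  finally show "norm (cinner (hcoeff f k) (hcoeff g k)) \<le> (norm (hcoeff f k))\<^sup>2 + (norm (hcoeff g k))\<^sup>2" .
qed

lemma h2inner_self: "f \<in> H2 \<Longrightarrow> h2inner f f = complex_of_real ((hnorm f)\<^sup>2)"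
  unfolding h2inner_def cinner_self hnorm_sq
  by (intro suminf_of_real[symmetric]) (simp add: H2_iff)

lemma h2inner_add_left:
  assumes "f \<in> H2" "g \<in> H2" "h \<in> H2"
  shows "h2inner (\<lambda>z. f z + g z) h = h2inner f h + h2inner g h"
  unfolding h2inner_def
  by (simp add: hcoeff_add assms[THEN H2_hol_vec] cinner_add_left suminf_add[OF summable_cinner summable_cinner] assms)

lemma h2inner_diff_left:
  assumes "f \<in> H2" "g \<in> H2" "h \<in> H2"
  shows "h2inner (\<lambda>z. f z - g z) h = h2inner f h - h2inner g h"
  unfolding h2inner_def
  by (simp add: hcoeff_diff assms[THEN H2_hol_vec] cinner_diff_left suminf_diff[OF summable_cinner summable_cinner] assms)

lemma h2inner_cscale_left:
  assumes "f \<in> H2" "h \<in> H2"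
  shows "h2inner (\<lambda>z. cscale c (f z)) h = c * h2inner f h"
  unfolding h2inner_def
  by (simp add: hcoeff_cscale assms[THEN H2_hol_vec] cinner_cscale_left suminf_mult summable_cinner assms)

lemma h2inner_commute:
  assumes "f \<in> H2" "g \<in> H2"
  shows "h2inner g f = cnj (h2inner f g)"
proof -
  have "(\<lambda>k. cinner (hcoeff f k) (hcoeff g k)) sums h2inner f g"
    unfolding h2inner_def by (intro summable_sums summable_cinner assms)
  hence "(\<lambda>k. cnj (cinner (hcoeff f k) (hcoeff g k))) sums cnj (h2inner f g)"
    by (simp add: sums_cnj)
  thus ?thesis
    by (simp add: h2inner_def sums_iff flip: cinner_commute)
qed

lemma h2inner_add_right:
  assumes "f \<in> H2" "g \<in> H2" "h \<in> H2"
  shows "h2inner h (\<lambda>z. f z + g z) = h2inner h f + h2inner h g"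
  using h2inner_add_left[OF assms] by (simp add: h2inner_commute[of _ h] H2_intros assms)

lemma h2inner_diff_right:
  assumes "f \<in> H2" "g \<in> H2" "h \<in> H2"
  shows "h2inner h (\<lambda>z. f z - g z) = h2inner h f - h2inner h g"
  using h2inner_diff_left[OF assms] by (simp add: h2inner_commute[of _ h] H2_intros assms)

lemma h2inner_cscale_right:
  assumes "f \<in> H2" "h \<in> H2"
  shows "h2inner h (\<lambda>z. cscale c (f z)) = cnj c * h2inner h f"
  using h2inner_cscale_left[OF assms] by (simp add: h2inner_commute[of _ h] H2_intros assms)

lemmas h2inner_simps = h2inner_add_left h2inner_add_right h2inner_diff_left h2inner_diff_right
  h2inner_cscale_left h2inner_cscale_right

lemma h2inner_disc_const_left: "h2inner (disc_const v) f = cinner v (f 0)"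
proof -
  have "h2inner (disc_const v) f = (\<Sum>k\<in>{0}. cinner (hcoeff (disc_const v) k) (hcoeff f k))"
    unfolding h2inner_def by (rule suminf_finite) (auto simp: hcoeff_disc_const)
  thus ?thesis by (simp add: hcoeff_disc_const hcoeff_0)
qed

lemma h2inner_disc_const_right: "h2inner f (disc_const v) = cinner (f 0) v"
proof -
  have "h2inner f (disc_const v) = (\<Sum>k\<in>{0}. cinner (hcoeff f k) (hcoeff (disc_const v) k))"
    unfolding h2inner_def by (rule suminf_finite) (auto simp: hcoeff_disc_const)
  thus ?thesis by (simp add: hcoeff_disc_const hcoeff_0)
qed

lemma h2inner_shiftz_left:
  assumes "f \<in> H2" "g \<in> H2"
  shows "h2inner (shiftz f) g = (\<Sum>k. cinner (hcoeff f k) (hcoeff g (Suc k)))"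
  unfolding h2inner_def
  using suminf_split_head[OF summable_cinner[OF H2_shiftz[OF assms(1)] assms(2)]]
  by (simp add: hcoeff_shiftz H2_hol_vec[OF assms(1)])

lemma h2inner_shiftz_shiftz:
  assumes "f \<in> H2" "g \<in> H2"
  shows "h2inner (shiftz f) (shiftz g) = h2inner f g"
  by (simp add: h2inner_shiftz_left H2_intros assms hcoeff_shiftz H2_hol_vec) (simp add: h2inner_def)

lemma h2inner_shiftz_disc_const: "h2inner (shiftz f) (disc_const v) = 0"
  by (simp add: h2inner_disc_const_right shiftz_def)

lemma hnorm_shiftz:
  assumes "f \<in> H2" shows "hnorm (shiftz f) = hnorm f"
proof -
  have "complex_of_real ((hnorm (shiftz f))\<^sup>2) = complex_of_real ((hnorm f)\<^sup>2)"
    using assms by (metis h2inner_self H2_shiftz h2inner_shiftz_shiftz)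
  thus ?thesis using assms by (simp only: of_real_eq_iff) (simp add: hnorm_nonneg H2_intros power2_eq_iff_nonneg)
qed

lemma hnorm_disc_const: "hnorm (disc_const v) = norm v"
proof -
  have "h2inner (disc_const v) (disc_const v) = complex_of_real ((norm v)\<^sup>2)"
    by (simp add: h2inner_disc_const_left cinner_self)
  hence "(hnorm (disc_const v))\<^sup>2 = (norm v)\<^sup>2"
    by (simp only: h2inner_self[OF H2_disc_const] of_real_eq_iff)
  thus ?thesis by (simp add: power2_eq_iff_nonneg hnorm_nonneg H2_intros)
qed

lemma norm_h2inner_le:
  assumes f: "f \<in> H2" and g: "g \<in> H2"
  shows "norm (h2inner f g) \<le> hnorm f * hnorm g"
proof (rule LIMSEQ_le_const2)
  show "(\<lambda>n. norm (\<Sum>k<n. cinner (hcoeff f k) (hcoeff g k))) \<longlonglongrightarrow> norm (h2inner f g)"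
    unfolding h2inner_def by (intro tendsto_norm summable_LIMSEQ summable_cinner assms)
  have L: "L2_set (\<lambda>k. norm (hcoeff h k)) {..<n} \<le> hnorm h" if "h \<in> H2" for h :: "complex \<Rightarrow> complex^'a" and n
    unfolding L2_set_def hnorm_def using that
    by (intro real_sqrt_le_mono sum_le_suminf) (auto simp: H2_iff)
  have "norm (\<Sum>k<n. cinner (hcoeff f k) (hcoeff g k)) \<le> hnorm f * hnorm g" for n
  proof -
    have "norm (\<Sum>k<n. cinner (hcoeff f k) (hcoeff g k)) \<le> (\<Sum>k<n. \<bar>norm (hcoeff f k)\<bar> * \<bar>norm (hcoeff g k)\<bar>)"
      by (rule order_trans[OF norm_sum]) (auto intro!: sum_mono norm_cinner_le)
    also have "\<dots> \<le> L2_set (\<lambda>k. norm (hcoeff f k)) {..<n} * L2_set (\<lambda>k. norm (hcoeff g k)) {..<n}"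
      by (rule L2_set_mult_ineq)
    also have "\<dots> \<le> hnorm f * hnorm g"
      by (intro mult_mono L assms hnorm_nonneg) (simp add: L2_set_nonneg)
    finally show ?thesis .
  qed
  thus "\<exists>N. \<forall>n\<ge>N. norm (\<Sum>k<n. cinner (hcoeff f k) (hcoeff g k)) \<le> hnorm f * hnorm g" by blast
qed

lemma hnorm_add_sq:
  assumes "f \<in> H2" "g \<in> H2"
  shows "(hnorm (\<lambda>z. f z + g z))\<^sup>2 = (hnorm f)\<^sup>2 + 2 * Re (h2inner f g) + (hnorm g)\<^sup>2"
proof -
  have "complex_of_real ((hnorm (\<lambda>z. f z + g z))\<^sup>2) =
      complex_of_real ((hnorm f)\<^sup>2) + (h2inner f g + cnj (h2inner f g)) + complex_of_real ((hnorm g)\<^sup>2)"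
    by (simp only: h2inner_self[symmetric] h2inner_commute[symmetric] H2_intros assms h2inner_simps)
       (simp add: algebra_simps)
  also have "\<dots> = complex_of_real ((hnorm f)\<^sup>2 + 2 * Re (h2inner f g) + (hnorm g)\<^sup>2)"
    by (simp add: complex_add_cnj)
  finally show ?thesis by (simp only: of_real_eq_iff)
qed

lemma hnorm_triangle:
  assumes "f \<in> H2" "g \<in> H2"
  shows "hnorm (\<lambda>z. f z + g z) \<le> hnorm f + hnorm g"
proof (rule power2_le_imp_le)
  have "Re (h2inner f g) \<le> hnorm f * hnorm g"
    using order_trans[OF complex_Re_le_cmod norm_h2inner_le[OF assms]] .
  thus "(hnorm (\<lambda>z. f z + g z))\<^sup>2 \<le> (hnorm f + hnorm g)\<^sup>2"
    by (simp add: hnorm_add_sq assms power2_sum)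
qed (simp add: hnorm_nonneg assms)

lemma hnorm_cscale:
  assumes "f \<in> H2" shows "hnorm (\<lambda>z. cscale c (f z)) = norm c * hnorm f"
proof -
  have "complex_of_real ((hnorm (\<lambda>z. cscale c (f z)))\<^sup>2) = complex_of_real ((norm c * hnorm f)\<^sup>2)"
    by (simp add: h2inner_self[symmetric] H2_intros assms h2inner_simps del: of_real_power)
       (simp add: h2inner_self assms power_mult_distrib complex_norm_square[symmetric] flip: mult.assoc)
  thus ?thesis using assms
    by (simp only: of_real_eq_iff) (simp add: hnorm_nonneg H2_intros power2_eq_iff_nonneg)
qed

text \<open>The conclusion is equality on the whole plane, which the cut-off in \<open>H2\<close>
  makes possible. Uniqueness in \<open>projK\<close> rests on it.\<close>

lemma hnorm_eq_0_imp:
  fixes f :: "complex \<Rightarrow> complex^'n::finite"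
  assumes "f \<in> H2" "hnorm f = 0" shows "f = (\<lambda>z. 0)"
proof
  fix z
  have "(\<Sum>k. (norm (hcoeff f k))\<^sup>2) = 0" using hnorm_sq[OF assms(1)] assms(2) by simp
  hence c: "hcoeff f k = 0" for k
    using assms(1) by (subst (asm) suminf_eq_zero_iff) (auto simp: H2_iff)
  show "f z = 0"
  proof (cases "norm z < 1")
    case True
    have "f z $ i = 0" for i
      using hol_vec_sums[OF H2_hol_vec[OF assms(1)] True, of i] by (simp add: c sums_iff)
    thus ?thesis by (simp add: vec_eq_iff)
  qed (use assms(1) in \<open>auto simp: H2_iff\<close>)
qed

text \<open>By Parseval a pointwise bound becomes a comparison of mean squares on every circle,
  uniform in the radius, and the Abel bound returns to coefficients. Products with \<Theta> and
  quotients by \<open>\<zeta> - z\<close> enter \<open>H2\<close> in this way.\<close>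

lemma dominated_H2:
  assumes f: "hol_vec f" "\<And>z. z \<notin> ball 0 1 \<Longrightarrow> f z = 0" and g: "g \<in> H2"
    and le: "\<And>z. z \<in> ball 0 1 \<Longrightarrow> norm (f z) \<le> C * norm (g z)" and C: "C \<ge> 0"
  shows "f \<in> H2" "hnorm f \<le> C * hnorm g"
proof -
  let ?I = "\<lambda>f n. integral\<^sup>L circ_measure (\<lambda>t. (norm (f (complex_of_real (radii n) * cis t)))\<^sup>2) / (2 * pi)"
  have hg: "hol_vec g" by (rule H2_hol_vec[OF g])
  have A: "(\<lambda>k. (norm (hcoeff f k))\<^sup>2 * ((radii n)\<^sup>2) ^ k) sums ?I f n" for n
    by (intro parseval_circle f radii_bounds)
  have B: "(\<lambda>k. (norm (hcoeff g k))\<^sup>2 * ((radii n)\<^sup>2) ^ k) sums ?I g n" for n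
    by (intro parseval_circle hg radii_bounds)
  have "?I f n \<le> (C * hnorm g)\<^sup>2" for n
  proof -
    have "integral\<^sup>L circ_measure (\<lambda>t. (norm (f (complex_of_real (radii n) * cis t)))\<^sup>2) \<le>
          integral\<^sup>L circ_measure (\<lambda>t. C\<^sup>2 * (norm (g (complex_of_real (radii n) * cis t)))\<^sup>2)"
    proof (rule integral_mono)
      show "integrable circ_measure (\<lambda>t. (norm (f (complex_of_real (radii n) * cis t)))\<^sup>2)"
        "integrable circ_measure (\<lambda>t. C\<^sup>2 * (norm (g (complex_of_real (radii n) * cis t)))\<^sup>2)"
        by (intro continuous_imp_integrable_real continuous_intros hol_vec_continuous_circle f hg radii_bounds)+
      fix t
      have "norm (f (complex_of_real (radii n) * cis t)) \<le> C * norm (g (complex_of_real (radii n) * cis t))"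
        using radii_bounds[of n] by (intro le) (auto simp: norm_mult)
      from power_mono[OF this, of 2]
      show "(norm (f (complex_of_real (radii n) * cis t)))\<^sup>2 \<le> C\<^sup>2 * (norm (g (complex_of_real (radii n) * cis t)))\<^sup>2"
        by (simp add: power_mult_distrib)
    qed
    hence "?I f n \<le> C\<^sup>2 * ?I g n" by (simp add: field_simps)
    also have "?I g n \<le> (hnorm g)\<^sup>2"
    proof -
      have "(norm (hcoeff g k))\<^sup>2 * ((radii n)\<^sup>2) ^ k \<le> (norm (hcoeff g k))\<^sup>2" for k
        using radii_bounds[of n] by (intro mult_left_le) (auto simp: power_le_one)
      thus ?thesis unfolding hnorm_sq[OF g]
        using g by (intro sums_le[OF _ B summable_sums]) (auto simp: H2_iff)
    qed
    finally show ?thesis by (simp add: power_mult_distrib mult_left_mono)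
  qed
  note bd = sums_of_abel_bound[of "\<lambda>k. (norm (hcoeff f k))\<^sup>2", OF _ A this]
  show H: "f \<in> H2" using f bd(1) by (auto simp: H2_iff)
  have "(hnorm f)\<^sup>2 \<le> (C * hnorm g)\<^sup>2"
    unfolding hnorm_sq[OF H] using bd(2) by simp
  thus "hnorm f \<le> C * hnorm g"
    by (rule power2_le_imp_le) (simp add: C hnorm_nonneg g)
qed

section \<open>Multiplication by an inner function\<close>

lemma tendsto_matrix_vector_mult:
  fixes a :: "complex^'n::finite^'n"
  assumes "(A \<longlongrightarrow> a) F" "(x \<longlongrightarrow> y) F"
  shows "((\<lambda>t. A t *v x t) \<longlongrightarrow> a *v y) F"
  unfolding matrix_vector_mult_def
  by (intro tendsto_intros tendsto_vec_lambda assms)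

lemma tendsto_hnorm:
  assumes "\<And>n. f n \<in> H2" "g \<in> H2" "(\<lambda>n. hnorm (\<lambda>z. g z - f n z)) \<longlonglongrightarrow> 0"
  shows "(\<lambda>n. hnorm (f n)) \<longlonglongrightarrow> hnorm g"
proof (rule LIM_zero_cancel, rule Lim_null_comparison)
  show "(\<lambda>n. hnorm (\<lambda>z. g z - f n z)) \<longlonglongrightarrow> 0" by fact
  have "\<bar>hnorm (f n) - hnorm g\<bar> \<le> hnorm (\<lambda>z. g z - f n z)" for n
  proof -
    have 1: "hnorm g \<le> hnorm (f n) + hnorm (\<lambda>z. g z - f n z)"
      using hnorm_triangle[of "f n" "\<lambda>z. g z - f n z"] assms by (simp add: H2_intros)
    have "(\<lambda>z. g z + cscale (-1) (g z - f n z)) = f n"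
      by (simp add: fun_eq_iff vec_eq_iff cscale_def)
    hence "hnorm (f n) \<le> hnorm g + hnorm (\<lambda>z. cscale (-1) (g z - f n z))"
      using hnorm_triangle[of g "\<lambda>z. cscale (-1) (g z - f n z)"] assms by (simp only: H2_intros)
    hence 2: "hnorm (f n) \<le> hnorm g + hnorm (\<lambda>z. g z - f n z)"
      using hnorm_cscale[of "\<lambda>z. g z - f n z" "-1"] assms by (simp add: H2_intros)
    from 1 2 show ?thesis by linarith
  qed
  thus "\<forall>\<^sub>F n in sequentially. norm (hnorm (f n) - hnorm g) \<le> hnorm (\<lambda>z. g z - f n z)" by simp
qed

text \<open>Kept apart from \<open>trunc\<close> because two properties are wanted that no single
  function has in general: the polynomial is continuous on the plane and so supplies boundary
  values, its cut-off version belongs to \<open>H2\<close>.\<close>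

definition taylor :: "(complex \<Rightarrow> complex^'n::finite) \<Rightarrow> nat \<Rightarrow> complex \<Rightarrow> complex^'n" where
  "taylor g n z = (\<Sum>k<n. cscale (z ^ k) (hcoeff g k))"

lemma taylor_component: "taylor g n z $ i = (\<Sum>k<n. hcoeff g k $ i * z ^ k)"
  by (simp add: taylor_def cscale_def mult.commute)

lemma continuous_taylor: "continuous_on A (taylor g n)"
proof -
  have "continuous_on A (\<lambda>z. \<chi> i. taylor g n z $ i)"
    unfolding taylor_component by (intro continuous_intros)
  thus ?thesis by simp
qed

definition trunc :: "(complex \<Rightarrow> complex^'n::finite) \<Rightarrow> nat \<Rightarrow> complex \<Rightarrow> complex^'n" where
  "trunc g n z = (if z \<in> ball 0 1 then taylor g n z else 0)"

lemma hol_vec_trunc: "hol_vec (trunc g n)"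
  unfolding hol_vec_def
proof
  fix i
  have "(\<lambda>z. \<Sum>k<n. hcoeff g k $ i * z ^ k) holomorphic_on ball 0 1"
    by (intro holomorphic_intros)
  thus "(\<lambda>z. trunc g n z $ i) holomorphic_on ball 0 1"
    by (rule holomorphic_transform) (auto simp: trunc_def taylor_component)
qed

lemma hcoeff_trunc: "hcoeff (trunc g n) k = (if k < n then hcoeff g k else 0)"
proof -
  have "(\<lambda>z. trunc g n z $ i) has_fps_expansion (\<Sum>k<n. fps_const (hcoeff g k $ i) * fps_X ^ k)" for i
  proof -
    have ev: "eventually (\<lambda>z. z \<in> ball (0::complex) 1) (nhds 0)"
      by (rule eventually_nhds_in_open) auto
    have "(\<lambda>z. \<Sum>k<n. hcoeff g k $ i * z ^ k) has_fps_expansion (\<Sum>k<n. fps_const (hcoeff g k $ i) * fps_X ^ k)"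
      by (intro fps_expansion_intros)
    moreover from ev have "eventually (\<lambda>z. (\<Sum>k<n. hcoeff g k $ i * z ^ k) = trunc g n z $ i) (nhds 0)"
      by eventually_elim (simp add: trunc_def taylor_component)
    ultimately show ?thesis
      unfolding has_fps_expansion_def by (auto elim: eventually_elim2)
  qed
  from hcoeff_eqI[of "trunc g n", OF this] show ?thesis
    by (simp add: vec_eq_iff fps_sum_nth fps_X_power_nth if_distrib cong: if_cong)
qed

lemma H2_trunc: "trunc g n \<in> H2"
proof -
  have "summable (\<lambda>k. (norm (hcoeff (trunc g n) k))\<^sup>2)"
    by (rule summable_finite[of "{..<n}"]) (auto simp: hcoeff_trunc)
  thus ?thesis using hol_vec_trunc[of g n] unfolding H2_iff by (auto simp: trunc_def)
qed

lemma hnorm_diff_trunc: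
  assumes "g \<in> H2"
  shows "(\<lambda>n. hnorm (\<lambda>z. g z - trunc g n z)) \<longlonglongrightarrow> 0"
proof -
  let ?a = "\<lambda>k. (norm (hcoeff g k))\<^sup>2"
  have summ: "summable ?a" using assms by (simp add: H2_iff)
  have eq: "hnorm (\<lambda>z. g z - trunc g n z) = sqrt (suminf ?a - sum ?a {..<n})" for n
  proof -
    have "(norm (hcoeff (\<lambda>z. g z - trunc g n z) k))\<^sup>2 = ?a k - (if k \<in> {..<n} then ?a k else 0)" for k
      by (simp add: hcoeff_diff H2_hol_vec assms hol_vec_trunc hcoeff_trunc)
    moreover have "(\<lambda>k. ?a k - (if k \<in> {..<n} then ?a k else 0)) sums (suminf ?a - sum ?a {..<n})"
      by (intro sums_diff summable_sums summ sums_If_finite_set) simp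
    ultimately show ?thesis by (simp add: hnorm_def sums_iff)
  qed
  have "(\<lambda>n. sqrt (suminf ?a - sum ?a {..<n})) \<longlonglongrightarrow> sqrt (suminf ?a - suminf ?a)"
    by (intro tendsto_intros summable_LIMSEQ summ)
  thus ?thesis by (simp add: eq)
qed

lemma multop_add: "multop \<Theta> (\<lambda>z. f z + g z) = (\<lambda>z. multop \<Theta> f z + multop \<Theta> g z)"
  and multop_diff: "multop \<Theta> (\<lambda>z. f z - g z) = (\<lambda>z. multop \<Theta> f z - multop \<Theta> g z)"
  and multop_cscale: "multop \<Theta> (\<lambda>z. cscale c (f z)) = (\<lambda>z. cscale c (multop \<Theta> f z))"
  and multop_shiftz: "multop \<Theta> (shiftz f) = shiftz (multop \<Theta> f)"
  by (simp_all add: multop_def shiftz_def matrix_vector_right_distrib matrix_vector_mult_diff_distrib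
      matrix_vector_mult_cscale)

lemma hol_vec_multop:
  assumes "bounded_analytic \<Theta>" "hol_vec g" shows "hol_vec (multop \<Theta> g)"
  using assms unfolding hol_vec_def multop_def matrix_vector_mult_def bounded_analytic_def
  by (auto intro!: holomorphic_intros)

lemma bounded_analytic_bound:
  assumes "bounded_analytic \<Theta>"
  obtains M where "M \<ge> 0" "\<And>z v. z \<in> ball 0 1 \<Longrightarrow> norm (\<Theta> z *v v) \<le> M * norm v"
proof -
  obtain M where M: "\<And>z. z \<in> ball 0 1 \<Longrightarrow> norm (\<Theta> z) \<le> M"
    using assms unfolding bounded_analytic_def bounded_iff by (metis imageI)
  show ?thesis
  proof (rule that[of M])
    show "M \<ge> 0" using M[of 0] norm_ge_zero[of "\<Theta> 0"] by (simp del: norm_ge_zero)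
    show "norm (\<Theta> z *v v) \<le> M * norm v" if "z \<in> ball 0 1" for z v
      using order_trans[OF norm_mat_vec_le mult_right_mono[OF M[OF that]]] by simp
  qed
qed

lemma
  assumes \<Theta>: "bounded_analytic \<Theta>" and M: "M \<ge> 0" "\<And>z v. z \<in> ball 0 1 \<Longrightarrow> norm (\<Theta> z *v v) \<le> M * norm v"
    and g: "g \<in> H2"
  shows H2_multop_bound: "multop \<Theta> g \<in> H2" and hnorm_multop_le: "hnorm (multop \<Theta> g) \<le> M * hnorm g"
  by (rule dominated_H2[of "multop \<Theta> g" g M];
      use g M hol_vec_multop[OF \<Theta>, of g] in \<open>auto simp: H2_iff multop_def\<close>)+

lemma H2_multop:
  assumes "bounded_analytic \<Theta>" "g \<in> H2" shows "multop \<Theta> g \<in> H2"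
  using bounded_analytic_bound[OF assms(1)] H2_multop_bound[OF assms(1) _ _ assms(2)] by metis

text \<open>The function \<open>p\<close> extends \<open>g\<close> continuously across the circle.
  The mean squares of \<open>g\<close> and of \<open>\<Theta> g\<close> on growing circles have the
  same limit, because the radial limit of \<Theta> at almost every point preserves the norm of
  \<open>p\<close> there.\<close>

lemma hnorm_multop_continuous:
  assumes inner: "inner_fun \<Theta>" and g: "g \<in> H2"
    and p: "continuous_on UNIV p" "\<And>z. z \<in> ball 0 1 \<Longrightarrow> g z = p z"
  shows "hnorm (multop \<Theta> g) = hnorm g"
proof -
  have ba: "bounded_analytic \<Theta>" using inner by (simp add: inner_fun_def)
  obtain M where M: "M \<ge> 0" "\<And>z v. z \<in> ball 0 1 \<Longrightarrow> norm (\<Theta> z *v v) \<le> M * norm v"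
    using bounded_analytic_bound[OF ba] by blast
  have "compact (p ` cball 0 1)" by (intro compact_continuous_image continuous_on_subset[OF p(1)]) auto
  then obtain P where P: "\<And>z. norm z \<le> 1 \<Longrightarrow> norm (p z) \<le> P"
    using compact_imp_bounded by (fastforce simp: bounded_iff)
  let ?z = "\<lambda>n t. complex_of_real (radii n) * cis t"
  let ?I = "\<lambda>f n. integral\<^sup>L circ_measure (\<lambda>t. (norm (f (?z n t)))\<^sup>2)"
  let ?L = "integral\<^sup>L circ_measure (\<lambda>t. (norm (p (cis t)))\<^sup>2)"
  have hol: "hol_vec g" "hol_vec (multop \<Theta> g)"
    using g ba by (auto intro: hol_vec_multop H2_hol_vec)
  have ball: "?z n t \<in> ball 0 1" for n t using radii_bounds[of n] by (simp add: norm_mult)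
  have zlim: "(\<lambda>n. ?z n t) \<longlonglongrightarrow> cis t" for t
    using tendsto_mult[OF tendsto_of_real[OF radii_LIMSEQ] tendsto_const[of "cis t"]] by simp
  have plim: "(\<lambda>n. g (?z n t)) \<longlonglongrightarrow> p (cis t)" for t
  proof -
    have "isCont p (cis t)" using p(1) by (simp add: continuous_on_eq_continuous_at)
    from isCont_tendsto_compose[OF this zlim] show ?thesis using p(2)[OF ball] by simp
  qed
  \<comment> \<open>Stated for an arbitrary \<open>f\<close> so that the same dominated convergence
    serves \<open>g\<close> and \<open>multop \<Theta> g\<close>.\<close>
  have conv: "?I f \<longlonglongrightarrow> ?L" if f: "hol_vec f" and C: "\<And>z. z \<in> ball 0 1 \<Longrightarrow> norm (f z) \<le> C"
    and AE: "AE t in circ_measure. (\<lambda>n. (norm (f (?z n t)))\<^sup>2) \<longlonglongrightarrow> (norm (p (cis t)))\<^sup>2" for f :: "complex \<Rightarrow> complex^'a" and C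
  proof (rule integral_dominated_convergence[where w = "\<lambda>_. C\<^sup>2"])
    have "continuous_on {0..2*pi} (\<lambda>t. p (cis t))"
      by (rule continuous_on_compose2[OF p(1)]) (auto intro!: continuous_intros)
    thus "(\<lambda>t. (norm (p (cis t)))\<^sup>2) \<in> borel_measurable circ_measure"
      by (intro continuous_imp_measurable_on_sets_lebesgue continuous_intros) auto
    show "(\<lambda>t. (norm (f (?z n t)))\<^sup>2) \<in> borel_measurable circ_measure" for n
      by (intro continuous_imp_measurable_on_sets_lebesgue continuous_intros hol_vec_continuous_circle f radii_bounds) auto
    show "AE t in circ_measure. norm ((norm (f (?z n t)))\<^sup>2) \<le> C\<^sup>2" for n
      using C[OF ball] by (intro AE_I2) (simp add: power_mono)
  qed (use AE in simp_all)
  have I1: "?I g \<longlonglongrightarrow> ?L"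
  proof (rule conv[OF hol(1), of P])
    show "norm (g z) \<le> P" if "z \<in> ball 0 1" for z using p(2)[OF that] P[of z] that by simp
    show "AE t in circ_measure. (\<lambda>n. (norm (g (?z n t)))\<^sup>2) \<longlonglongrightarrow> (norm (p (cis t)))\<^sup>2"
      by (intro AE_I2 tendsto_intros plim)
  qed
  have I2: "?I (multop \<Theta> g) \<longlonglongrightarrow> ?L"
  proof (rule conv[OF hol(2), of "M * P"])
    show "norm (multop \<Theta> g z) \<le> M * P" if "z \<in> ball 0 1" for z
    proof -
      have "norm (multop \<Theta> g z) \<le> M * norm (g z)" using M(2)[OF that] by (simp add: multop_def)
      also have "\<dots> \<le> M * P" using p(2)[OF that] P[of z] that M(1) by (intro mult_left_mono) auto
      finally show ?thesis .
    qed
    have "AE t in circ_measure. \<exists>L. ((\<lambda>r. \<Theta> (complex_of_real r * cis t)) \<longlongrightarrow> L) (at_left 1) \<and> isometry_mat L"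
      using inner by (simp add: inner_fun_def)
    thus "AE t in circ_measure. (\<lambda>n. (norm (multop \<Theta> g (?z n t)))\<^sup>2) \<longlonglongrightarrow> (norm (p (cis t)))\<^sup>2"
    proof (rule AE_mp, intro AE_I2 impI)
      fix t assume "\<exists>L. ((\<lambda>r. \<Theta> (complex_of_real r * cis t)) \<longlongrightarrow> L) (at_left 1) \<and> isometry_mat L"
      then obtain L where L: "((\<lambda>r. \<Theta> (complex_of_real r * cis t)) \<longlongrightarrow> L) (at_left 1)" "isometry_mat L"
        by blast
      have "(\<lambda>n. \<Theta> (?z n t)) \<longlonglongrightarrow> L" by (rule filterlim_compose[OF L(1) radii_at_left])
      from tendsto_power[OF tendsto_norm[OF tendsto_matrix_vector_mult[OF this plim]], where n = 2]
      show "(\<lambda>n. (norm (multop \<Theta> g (?z n t)))\<^sup>2) \<longlonglongrightarrow> (norm (p (cis t)))\<^sup>2"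
        using L(2) by (simp add: multop_def isometry_mat_def)
    qed
  qed
  have fin: "(\<lambda>k. (norm (hcoeff f k))\<^sup>2) sums (?L / (2 * pi))" if "hol_vec f" "?I f \<longlonglongrightarrow> ?L" for f :: "complex \<Rightarrow> complex^'a"
    by (rule sums_of_abel_limit[OF _ parseval_circle[OF that(1) radii_bounds]])
       (auto intro!: tendsto_divide that)
  show ?thesis using fin[OF hol(1) I1] fin[OF hol(2) I2] by (simp add: hnorm_def sums_iff)
qed

text \<open>Since \<Theta> is bounded, both sides are continuous in the norm of H^2, and the
  truncations of \<open>g\<close> converge to \<open>g\<close>.\<close>

lemma hnorm_multop:
  assumes inner: "inner_fun \<Theta>" and g: "g \<in> H2"
  shows "hnorm (multop \<Theta> g) = hnorm g"
proof -
  have ba: "bounded_analytic \<Theta>" using inner by (simp add: inner_fun_def)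
  obtain M where M: "M \<ge> 0" "\<And>z v. z \<in> ball 0 1 \<Longrightarrow> norm (\<Theta> z *v v) \<le> M * norm v"
    using bounded_analytic_bound[OF ba] by blast
  have lim: "(\<lambda>n. hnorm (trunc g n)) \<longlonglongrightarrow> hnorm g"
    by (intro tendsto_hnorm H2_trunc g hnorm_diff_trunc)
  have "(\<lambda>n. hnorm (\<lambda>z. multop \<Theta> g z - multop \<Theta> (trunc g n) z)) \<longlonglongrightarrow> 0"
  proof (rule tendsto_sandwich[OF _ _ tendsto_const])
    show "(\<lambda>n. M * hnorm (\<lambda>z. g z - trunc g n z)) \<longlonglongrightarrow> 0"
      using tendsto_mult[OF tendsto_const[of M] hnorm_diff_trunc[OF g]] by simp
    show "\<forall>\<^sub>F n in sequentially. 0 \<le> hnorm (\<lambda>z. multop \<Theta> g z - multop \<Theta> (trunc g n) z)"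
      by (simp add: hnorm_nonneg H2_intros H2_multop ba g H2_trunc)
    show "\<forall>\<^sub>F n in sequentially. hnorm (\<lambda>z. multop \<Theta> g z - multop \<Theta> (trunc g n) z) \<le> M * hnorm (\<lambda>z. g z - trunc g n z)"
      using hnorm_multop_le[OF ba M H2_diff[OF g H2_trunc]] by (simp add: multop_diff)
  qed
  hence "(\<lambda>n. hnorm (multop \<Theta> (trunc g n))) \<longlonglongrightarrow> hnorm (multop \<Theta> g)"
    by (intro tendsto_hnorm H2_multop ba H2_trunc g)
  moreover have "hnorm (multop \<Theta> (trunc g n)) = hnorm (trunc g n)" for n
    by (rule hnorm_multop_continuous[OF inner H2_trunc continuous_taylor]) (simp add: trunc_def)
  ultimately show ?thesis using LIMSEQ_unique[OF lim] by simp
qed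

text \<open>Polarization: equality of norms gives equal real parts, and replacing \<open>f\<close>
  by \<open>\<i> f\<close> gives the imaginary parts.\<close>

lemma h2inner_multop:
  assumes inner: "inner_fun \<Theta>" and f: "f \<in> H2" and g: "g \<in> H2"
  shows "h2inner (multop \<Theta> f) (multop \<Theta> g) = h2inner f g"
proof -
  have ba: "bounded_analytic \<Theta>" using inner by (simp add: inner_fun_def)
  note I = H2_intros H2_multop[OF ba] f g
  have Re: "Re (h2inner (multop \<Theta> f) (multop \<Theta> g)) = Re (h2inner f g)" if f: "f \<in> H2" for f
    using hnorm_add_sq[of f g] hnorm_add_sq[of "multop \<Theta> f" "multop \<Theta> g"] hnorm_multop[OF inner] that
    by (simp add: I flip: multop_add)
  have "Re (h2inner (multop \<Theta> (\<lambda>z. cscale \<i> (f z))) (multop \<Theta> g)) = Re (h2inner (\<lambda>z. cscale \<i> (f z)) g)"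
    by (intro Re I)
  hence "Im (h2inner (multop \<Theta> f) (multop \<Theta> g)) = Im (h2inner f g)"
    by (simp add: multop_cscale h2inner_simps I)
  with Re[OF f] show ?thesis by (simp add: complex_eq_iff)
qed

section \<open>The model space and the dilation\<close>

text \<open>The backward shift, adjoint to \<open>shiftz\<close>. It has the shape of
  \<open>iota\<close>, including the derivative as the value at 0.\<close>

definition bshift :: "(complex \<Rightarrow> complex^'n::finite) \<Rightarrow> complex \<Rightarrow> complex^'n" where
  "bshift f z = (if z \<in> ball 0 1 then
     (if z = 0 then (\<chi> i. deriv (\<lambda>z. f z $ i) 0) else cscale (1 / z) (f z - f 0)) else 0)"

lemma hol_vec_bshift:
  assumes "hol_vec f" shows "hol_vec (bshift f)"
  unfolding hol_vec_def
proof
  fix i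
  have "(\<lambda>z. if z = 0 then deriv (\<lambda>z. f z $ i) 0 else (f z $ i - f 0 $ i) / (z - 0)) holomorphic_on ball 0 1"
    using assms by (intro pole_lemma_open) (auto simp: hol_vec_def)
  thus "(\<lambda>z. bshift f z $ i) holomorphic_on ball 0 1"
    by (rule holomorphic_transform) (auto simp: bshift_def cscale_def)
qed

lemma shiftz_bshift:
  assumes "\<And>z. z \<notin> ball 0 1 \<Longrightarrow> f z = 0"
  shows "(\<lambda>z. disc_const (f 0) z + shiftz (bshift f) z) = f"
  using assms by (auto simp: fun_eq_iff disc_const_def shiftz_def bshift_def cscale_cscale)

lemma hcoeff_bshift:
  assumes "f \<in> H2" shows "hcoeff (bshift f) k = hcoeff f (Suc k)"
proof -
  have hol: "hol_vec f" by (rule H2_hol_vec[OF assms])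
  have "(\<lambda>z. disc_const (f 0) z + shiftz (bshift f) z) = f"
    using assms by (intro shiftz_bshift) (auto simp: H2_iff)
  from arg_cong[OF this, of "\<lambda>h. hcoeff h (Suc k)"] show ?thesis
    by (simp add: hcoeff_add hol_vec_disc_const hol_vec_shiftz hol_vec_bshift hol hcoeff_disc_const hcoeff_shiftz)
qed

lemma H2_bshift:
  assumes "f \<in> H2" shows "bshift f \<in> H2"
proof -
  have "summable (\<lambda>k. (norm (hcoeff (bshift f) k))\<^sup>2)"
    using assms by (subst hcoeff_bshift) (simp_all add: H2_iff summable_Suc_iff[of "\<lambda>k. (norm (hcoeff f k))\<^sup>2"])
  thus ?thesis using hol_vec_bshift[OF H2_hol_vec[OF assms]] by (simp add: H2_iff) (simp add: bshift_def)
qed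

lemma h2inner_bshift_right:
  assumes "f \<in> H2" "g \<in> H2" shows "h2inner f (bshift g) = h2inner (shiftz f) g"
  using assms by (simp add: h2inner_shiftz_left) (simp add: h2inner_def hcoeff_bshift)

lemma h2inner_sum_right:
  assumes "finite A" "h \<in> H2" "\<And>i. F i \<in> H2"
  shows "(\<lambda>z. \<Sum>i\<in>A. cscale (x i) (F i z)) \<in> H2 \<and>
    h2inner h (\<lambda>z. \<Sum>i\<in>A. cscale (x i) (F i z)) = (\<Sum>i\<in>A. cnj (x i) * h2inner h (F i))"
  using assms(1)
proof induction
  case empty
  have "h2inner h (disc_const 0) = 0" by (simp add: h2inner_disc_const_right)
  thus ?case by (simp add: H2_zero disc_const_def cong: if_cong)
next
  case (insert i A)
  thus ?case using assms by (simp add: H2_intros h2inner_simps)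
qed

section \<open>Model space, compressed shift and dilation of a pure inner function\<close>

locale pure_inner =
  fixes \<Theta> :: "complex \<Rightarrow> complex^'n::finite^'n"
  assumes inner: "inner_fun \<Theta>" and pure: "pure_fun \<Theta>"
begin

lemma analytic: "bounded_analytic \<Theta>"
  using inner by (simp add: inner_fun_def)

lemma contr: "x \<noteq> 0 \<Longrightarrow> norm (\<Theta> 0 *v x) < norm x"
  using pure by (simp add: pure_fun_def)

lemma contr_adj: "x \<noteq> 0 \<Longrightarrow> norm (adj (\<Theta> 0) *v x) < norm x"
  using strict_contraction_adj[of "\<Theta> 0"] contr by blast

lemmas multop_H2 = H2_multop[OF analytic]
lemmas multop_isometry = h2inner_multop[OF inner]

abbreviation \<Theta>c :: "complex^'n \<Rightarrow> complex \<Rightarrow> complex^'n" where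
  "\<Theta>c v \<equiv> multop \<Theta> (disc_const v)"

lemma \<Theta>c_H2: "\<Theta>c v \<in> H2"
  by (intro multop_H2 H2_disc_const)

lemma \<Theta>c_0 [simp]: "\<Theta>c v 0 = \<Theta> 0 *v v"
  by (simp add: multop_def)

lemma KTheta_H2: "f \<in> KTheta \<Theta> \<Longrightarrow> f \<in> H2"
  by (simp add: KTheta_def)

lemma KTheta_orth:
  assumes "f \<in> KTheta \<Theta>" "g \<in> H2"
  shows "h2inner f (multop \<Theta> g) = 0" "h2inner (multop \<Theta> g) f = 0"
  using assms h2inner_commute[of f "multop \<Theta> g"] by (auto simp: KTheta_def multop_H2)

lemma KTheta_diff: "f \<in> KTheta \<Theta> \<Longrightarrow> g \<in> KTheta \<Theta> \<Longrightarrow> (\<lambda>z. f z - g z) \<in> KTheta \<Theta>"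
  by (auto simp: KTheta_def H2_diff h2inner_diff_left multop_H2)

lemma KTheta_cscale: "f \<in> KTheta \<Theta> \<Longrightarrow> (\<lambda>z. cscale c (f z)) \<in> KTheta \<Theta>"
  by (auto simp: KTheta_def H2_cscale h2inner_cscale_left multop_H2)

text \<open>The Riesz vector of the antilinear map in \<open>cinner_shift_coeff\<close>. As \<Theta>
  acts isometrically, \<open>\<Theta>c (shift_coeff f)\<close> is the projection of
  \<open>z f\<close> onto the functions \<open>\<Theta> v\<close>, which for \<open>f\<close> in the
  model space is all that leads out of that space.\<close>

definition shift_coeff :: "(complex \<Rightarrow> complex^'n) \<Rightarrow> complex^'n" where
  "shift_coeff f = (\<chi> i. h2inner (shiftz f) (\<Theta>c (axis i 1)))"

lemma cinner_shift_coeff: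
  assumes "f \<in> H2"
  shows "cinner (shift_coeff f) v = h2inner (shiftz f) (\<Theta>c v)"
proof -
  have "\<Theta>c v z = (\<Sum>i\<in>UNIV. cscale (v $ i) (\<Theta>c (axis i 1) z))" for z
    by (simp add: multop_def disc_const_def vec_eq_iff cscale_def matrix_vector_mult_def axis_def if_distrib cong: if_cong)
       (simp add: mult.commute)
  hence eq: "\<Theta>c v = (\<lambda>z. \<Sum>i\<in>UNIV. cscale (v $ i) (\<Theta>c (axis i 1) z))" by blast
  show ?thesis
    using h2inner_sum_right[of UNIV "shiftz f" "\<lambda>i. \<Theta>c (axis i 1)" "\<lambda>i. v $ i"] assms
    by (subst eq) (simp add: H2_intros \<Theta>c_H2 cinner_def shift_coeff_def mult.commute)
qed

text \<open>Write \<open>g\<close> as \<open>g 0\<close> plus \<open>z\<close> times its backward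
  shift. Against the second part \<open>z f\<close> pairs like \<open>f\<close> with a multiple of
  \<Theta>, hence to 0. What remains is the pairing with \<open>\<Theta> (g 0)\<close>, and the
  correction term cancels it.\<close>

lemma compressed_shift_in_KTheta:
  assumes f: "f \<in> KTheta \<Theta>"
  shows "(\<lambda>z. shiftz f z - \<Theta>c (shift_coeff f) z) \<in> KTheta \<Theta>"
  unfolding KTheta_def
proof safe
  note I = H2_intros \<Theta>c_H2 multop_H2 KTheta_H2[OF f]
  show "(\<lambda>z. shiftz f z - \<Theta>c (shift_coeff f) z) \<in> H2" by (intro I)
  fix g :: "complex \<Rightarrow> complex^'n" assume g: "g \<in> H2"
  have dec: "(\<lambda>z. disc_const (g 0) z + shiftz (bshift g) z) = g"
    using g by (intro shiftz_bshift) (auto simp: H2_iff)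
  have "h2inner (shiftz f) (multop \<Theta> g) = h2inner (shiftz f) (\<Theta>c (g 0)) + h2inner (shiftz f) (shiftz (multop \<Theta> (bshift g)))"
    by (subst dec[symmetric], subst multop_add, subst h2inner_add_right)
       (auto intro!: I H2_bshift g simp: multop_shiftz)
  also have "\<dots> = cinner (shift_coeff f) (g 0)"
    using KTheta_orth(1)[OF f H2_bshift[OF g]]
    by (simp add: cinner_shift_coeff I h2inner_shiftz_shiftz H2_bshift g)
  finally show "h2inner (\<lambda>z. shiftz f z - \<Theta>c (shift_coeff f) z) (multop \<Theta> g) = 0"
    by (simp add: h2inner_simps I g multop_isometry h2inner_disc_const_left)
qed

text \<open>The difference between \<open>z f\<close> and the explicit candidate is a multiple of
  \<Theta>, hence orthogonal to the model space. Two candidates differ by an element of the model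
  space that is orthogonal to itself.\<close>

lemma STheta_eq:
  assumes f: "f \<in> KTheta \<Theta>"
  shows "STheta \<Theta> f = (\<lambda>z. shiftz f z - \<Theta>c (shift_coeff f) z)"
  unfolding STheta_def projK_def
proof (rule the_equality, intro conjI ballI)
  note I = H2_intros \<Theta>c_H2 multop_H2 KTheta_H2[OF f]
  let ?g = "\<lambda>z. shiftz f z - \<Theta>c (shift_coeff f) z"
  show gK: "?g \<in> KTheta \<Theta>" by (rule compressed_shift_in_KTheta[OF f])
  show perp: "h2inner (\<lambda>z. shiftz f z - ?g z) k = 0" if "k \<in> KTheta \<Theta>" for k
    using KTheta_orth(2)[OF that H2_disc_const] by simp
  fix g assume g: "g \<in> KTheta \<Theta> \<and> (\<forall>k\<in>KTheta \<Theta>. h2inner (\<lambda>z. shiftz f z - g z) k = 0)"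
  let ?k = "\<lambda>z. ?g z - g z"
  have kK: "?k \<in> KTheta \<Theta>" using KTheta_diff[OF gK, of g] g by simp
  have H: "g \<in> H2" "?g \<in> H2" "?k \<in> H2" using g gK kK KTheta_H2 by auto
  have "?k = (\<lambda>z. (shiftz f z - g z) - (shiftz f z - ?g z))" by (simp add: fun_eq_iff)
  hence "h2inner ?k ?k = h2inner (\<lambda>z. (shiftz f z - g z) - (shiftz f z - ?g z)) ?k"
    by (rule arg_cong[where f = "\<lambda>h. h2inner h ?k"])
  also have "\<dots> = h2inner (\<lambda>z. shiftz f z - g z) ?k - h2inner (\<lambda>z. shiftz f z - ?g z) ?k"
    by (intro h2inner_diff_left I H)
  also have "\<dots> = 0" using g kK perp by simp
  finally have "hnorm ?k = 0" using h2inner_self[OF H(3)] by simp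
  from hnorm_eq_0_imp[OF H(3) this] show "g = ?g" by (simp add: fun_eq_iff)
qed

text \<open>In this form \<open>iota\<close> can be moved across the inner product, where the
  backward shift becomes \<open>shiftz\<close>.\<close>

lemma iota_defect: "iota \<Theta> (defect (\<Theta> 0) *v \<xi>) = bshift (\<Theta>c \<xi>)"
proof
  fix z :: complex
  have the: "(THE \<xi>'. defect (\<Theta> 0) *v \<xi>' = defect (\<Theta> 0) *v \<xi>) = \<xi>"
    using defect_inj[of "\<Theta> 0"] contr by (intro the_equality) auto
  have "deriv (\<lambda>z. \<Theta>c \<xi> z $ i) 0 = (dTheta0 \<Theta> *v \<xi>) $ i" for i
  proof (rule DERIV_imp_deriv)
    have "((\<lambda>z. \<Theta> z $ i $ j) has_field_derivative deriv (\<lambda>z. \<Theta> z $ i $ j) 0) (at 0)" for j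
      using analytic by (intro holomorphic_derivI[of _ "ball 0 1"]) (auto simp: bounded_analytic_def)
    hence "((\<lambda>z. \<Sum>j\<in>UNIV. \<Theta> z $ i $ j * \<xi> $ j) has_field_derivative (\<Sum>j\<in>UNIV. deriv (\<lambda>z. \<Theta> z $ i $ j) 0 * \<xi> $ j)) (at 0)"
      by (intro DERIV_sum DERIV_cmult_right)
    hence "((\<lambda>z. \<Theta>c \<xi> z $ i) has_field_derivative (\<Sum>j\<in>UNIV. deriv (\<lambda>z. \<Theta> z $ i $ j) 0 * \<xi> $ j)) (at 0)"
      by (rule has_field_derivative_transform_within_open[where S = "ball 0 1"])
         (auto simp: multop_def disc_const_def matrix_vector_mult_def)
    thus "((\<lambda>z. \<Theta>c \<xi> z $ i) has_field_derivative (dTheta0 \<Theta> *v \<xi>) $ i) (at 0)"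
      by (simp add: dTheta0_def matrix_vector_mult_def)
  qed
  hence d: "(\<chi> i. deriv (\<lambda>z. \<Theta>c \<xi> z $ i) 0) = dTheta0 \<Theta> *v \<xi>" by (simp add: vec_eq_iff)
  show "iota \<Theta> (defect (\<Theta> 0) *v \<xi>) z = bshift (\<Theta>c \<xi>) z"
    unfolding iota_def the bshift_def d Let_def
    by (simp add: multop_def disc_const_def matrix_vector_mult_diff_rdistrib)
qed

text \<open>With \<open>D\<close> the self-adjoint defect, \<open>D\<close> applied to the adjoint
  of \<open>iota\<close> pairs with \<open>\<xi>\<close> like \<open>f\<close> with
  \<open>iota (D \<xi>)\<close>, that is with the backward shift of \<open>\<Theta> \<xi>\<close>,
  hence like \<open>z f\<close> with \<open>\<Theta> \<xi>\<close>.\<close>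

lemma defect_iota_adj:
  assumes f: "f \<in> H2"
  shows "defect (\<Theta> 0) *v iota_adj \<Theta> f = shift_coeff f"
proof -
  let ?D = "defect (\<Theta> 0)"
  obtain v where v: "?D *v v = shift_coeff f"
    using defect_surj[of "\<Theta> 0" "shift_coeff f"] contr by blast
  have *: "cinner v \<eta> = h2inner f (iota \<Theta> \<eta>)" for \<eta>
  proof -
    obtain \<xi> where \<xi>: "\<eta> = ?D *v \<xi>"
      using defect_surj[of "\<Theta> 0" \<eta>] contr by blast
    have "cinner v (?D *v \<xi>) = cinner (?D *v v) \<xi>"
      using adj_defect[of "\<Theta> 0"] contr by (simp add: cinner_adj)
    thus ?thesis by (simp add: \<xi> iota_defect h2inner_bshift_right f \<Theta>c_H2 v cinner_shift_coeff)
  qed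
  have "iota_adj \<Theta> f = v"
    unfolding iota_adj_def
  proof (rule the_equality)
    fix u assume u: "\<forall>\<eta>. cinner u \<eta> = h2inner f (iota \<Theta> \<eta>)"
    have "u - v = 0" by (rule cinner_eq_0_imp) (simp add: cinner_diff_left u *)
    thus "u = v" by simp
  qed (simp add: *)
  thus ?thesis by (simp add: v)
qed

lemma iota_star_defect:
  "iota_star \<Theta> (defect (adj (\<Theta> 0)) *v w) = (\<lambda>z. disc_const w z - \<Theta>c (adj (\<Theta> 0) *v w) z)"
proof -
  have "(THE \<xi>'. defect (adj (\<Theta> 0)) *v \<xi>' = defect (adj (\<Theta> 0)) *v w) = w"
    using defect_inj[of "adj (\<Theta> 0)"] contr_adj by (intro the_equality) auto
  thus ?thesis by (auto simp: iota_star_def fun_eq_iff disc_const_def multop_def)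
qed

text \<open>The reproducing kernel of the model space at 0: both of its terms pair with
  \<open>\<Theta> g\<close> to \<open>cinner w (\<Theta> 0 *v g 0)\<close>.\<close>

lemma iota_star_in_KTheta: "(\<lambda>z. disc_const w z - \<Theta>c (adj (\<Theta> 0) *v w) z) \<in> KTheta \<Theta>"
  by (auto simp: KTheta_def H2_intros \<Theta>c_H2 multop_H2 h2inner_simps multop_isometry h2inner_disc_const_left
      cinner_adj') (simp add: multop_def cinner_adj' )

text \<open>Identifies a pair in the direct sum with a single function in H^2;
  \<open>hnorm_model_sq\<close> shows that the identification preserves norms.\<close>

definition model :: "(complex \<Rightarrow> complex^'n) \<Rightarrow> complex^'n \<Rightarrow> complex \<Rightarrow> complex^'n" where
  "model f v = (\<lambda>z. f z + \<Theta>c v z)"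

definition pert_shift :: "(complex \<Rightarrow> complex^'n) \<Rightarrow> complex^'n \<Rightarrow> complex \<Rightarrow> complex^'n" where
  "pert_shift f w = (\<lambda>z. shiftz f z + disc_const w z)"

lemma H2_model: "f \<in> H2 \<Longrightarrow> model f v \<in> H2"
  and H2_pert_shift: "f \<in> H2 \<Longrightarrow> pert_shift f w \<in> H2"
  by (simp_all add: model_def pert_shift_def H2_intros \<Theta>c_H2)

text \<open>With \<open>w = \<Omega> v\<close>, the first component of the dilation is
  \<open>z f + w\<close> minus \<Theta> times the vector
  \<open>shift_coeff f + adj (\<Theta> 0) w\<close>, and that vector is exactly the second
  component. Under \<open>model\<close> the two contributions cancel and \<open>z f + w\<close> is
  left.\<close>

lemma UOmega_form:
  assumes f: "f \<in> KTheta \<Theta>"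
  shows "sum_inner (UOmega \<Theta> \<Omega> (f, v)) (f, v) = h2inner (pert_shift f (\<Omega> *v v)) (model f v)"
proof -
  let ?w = "\<Omega> *v v"
  note I = H2_intros \<Theta>c_H2 multop_H2 KTheta_H2[OF f]
  show ?thesis
    by (simp add: UOmega_def sum_inner_def STheta_eq f iota_star_defect defect_iota_adj I h2inner_simps
        model_def pert_shift_def KTheta_orth[OF f H2_disc_const] cinner_add_left cinner_shift_coeff
        h2inner_disc_const_left cinner_adj matrix_vector_right_distrib cinner_add_right)
qed

lemma hnorm_model_sq:
  assumes "f \<in> KTheta \<Theta>" shows "(hnorm (model f v))\<^sup>2 = (hnorm f)\<^sup>2 + (norm v)\<^sup>2"
  using assms unfolding model_def
  by (simp add: hnorm_add_sq KTheta_H2 \<Theta>c_H2 KTheta_orth H2_disc_const hnorm_multop[OF inner] hnorm_disc_const)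

lemma hnorm_pert_shift_sq:
  assumes "f \<in> H2" shows "(hnorm (pert_shift f w))\<^sup>2 = (hnorm f)\<^sup>2 + (norm w)\<^sup>2"
  using assms unfolding pert_shift_def
  by (simp add: hnorm_add_sq H2_intros h2inner_shiftz_disc_const hnorm_shiftz hnorm_disc_const)

lemma numrange_U_eq:
  "numrange_U \<Theta> \<Omega> = {h2inner (pert_shift f (\<Omega> *v v)) (model f v) | f v.
      f \<in> KTheta \<Theta> \<and> (hnorm f)\<^sup>2 + (norm v)\<^sup>2 = 1}"
proof -
  have "sum_inner (f, v) (f, v) = 1 \<longleftrightarrow> (hnorm f)\<^sup>2 + (norm v)\<^sup>2 = 1" if "f \<in> KTheta \<Theta>" for f v
  proof -
    have "sum_inner (f, v) (f, v) = complex_of_real ((hnorm f)\<^sup>2 + (norm v)\<^sup>2)"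
      using that by (simp add: sum_inner_def h2inner_self KTheta_H2 cinner_self)
    thus ?thesis by (simp only: of_real_eq_1_iff)
  qed
  thus ?thesis unfolding numrange_U_def
    by (auto simp: UOmega_form) (metis UOmega_form fst_conv)+
qed

lemma numrange_S_eq:
  "numrange_S \<Theta> = {h2inner (shiftz f) f | f. f \<in> KTheta \<Theta> \<and> hnorm f = 1}"
proof -
  have "h2inner f f = 1 \<longleftrightarrow> hnorm f = 1" if "f \<in> KTheta \<Theta>" for f
  proof -
    have "h2inner f f = 1 \<longleftrightarrow> (hnorm f)\<^sup>2 = 1"
      using that by (simp add: h2inner_self KTheta_H2 del: of_real_power)
    thus ?thesis using hnorm_nonneg[OF KTheta_H2[OF that]] by (simp add: power2_eq_1_iff)
  qed
  moreover have "h2inner (STheta \<Theta> f) f = h2inner (shiftz f) f" if "f \<in> KTheta \<Theta>" for f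
    using that by (simp add: STheta_eq h2inner_simps H2_intros \<Theta>c_H2 KTheta_H2 KTheta_orth H2_disc_const)
  ultimately show ?thesis unfolding numrange_S_def by metis
qed

text \<open>The kernel at 0 for a vector \<open>w\<close> has the value
  \<open>w - \<Theta> 0 (adj (\<Theta> 0) w)\<close> at 0. Were this zero,
  \<open>adj (\<Theta> 0)\<close> would preserve the norm of \<open>w\<close>, against
  purity.\<close>

lemma ex_unit_KTheta: "\<exists>f\<in>KTheta \<Theta>. hnorm f = 1"
proof -
  define w :: "complex^'n" where "w = axis undefined 1"
  have w: "w \<noteq> 0" by (simp add: w_def axis_eq_0_iff)
  define k where "k = (\<lambda>z. disc_const w z - \<Theta>c (adj (\<Theta> 0) *v w) z)"
  have k: "k \<in> KTheta \<Theta>" unfolding k_def by (rule iota_star_in_KTheta)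
  have "k 0 \<noteq> 0"
  proof
    assume "k 0 = 0"
    hence "cinner w w = cinner (adj (\<Theta> 0) *v w) (adj (\<Theta> 0) *v w)"
      by (simp add: k_def cinner_adj')
    hence "norm (adj (\<Theta> 0) *v w) = norm w"
      unfolding cinner_self by (simp add: power2_eq_iff_nonneg del: of_real_power)
    thus False using contr_adj[OF w] by simp
  qed
  hence "hnorm k \<noteq> 0" using hnorm_eq_0_imp[OF KTheta_H2[OF k]] by auto
  hence "hnorm (\<lambda>z. cscale (1 / of_real (hnorm k)) (k z)) = 1"
    using hnorm_nonneg[OF KTheta_H2[OF k]] by (simp add: hnorm_cscale KTheta_H2 k norm_divide)
  thus ?thesis using KTheta_cscale[OF k] by blast
qed

end

section \<open>Resolvent kernels\<close>

lemma H2_bshift_power: "f \<in> H2 \<Longrightarrow> (bshift ^^ j) f \<in> H2"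
  by (induction j) (auto intro: H2_bshift)

lemma h2inner_bshift_power:
  assumes "f \<in> H2" "g \<in> H2"
  shows "h2inner f ((bshift ^^ j) g) = h2inner ((shiftz ^^ j) f) g"
  using assms
proof (induction j arbitrary: f)
  case (Suc j)
  have "h2inner f ((bshift ^^ Suc j) g) = h2inner (shiftz f) ((bshift ^^ j) g)"
    using Suc.prems by (simp add: h2inner_bshift_right H2_bshift_power)
  also have "\<dots> = h2inner ((shiftz ^^ Suc j) f) g"
    using Suc.IH[of "shiftz f"] Suc.prems by (simp add: H2_shiftz funpow_swap1)
  finally show ?case .
qed simp

lemma bshift_power_0:
  assumes "f \<in> H2" shows "(bshift ^^ j) f 0 = hcoeff f j"
  using assms
proof (induction j arbitrary: f)
  case (Suc j)
  thus ?case by (simp add: funpow_Suc_right H2_bshift hcoeff_bshift del: funpow.simps(2))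
qed (simp add: hcoeff_0)

text \<open>The backward shift is the adjoint of an isometry, hence a contraction.\<close>

lemma hnorm_bshift_power_le:
  assumes "f \<in> H2" shows "hnorm ((bshift ^^ j) f) \<le> hnorm f"
proof (induction j)
  case (Suc j)
  have "hnorm (bshift g) \<le> hnorm g" if g: "g \<in> H2" for g :: "complex \<Rightarrow> complex^'a"
  proof -
    have "(hnorm (bshift g))\<^sup>2 = norm (h2inner (bshift g) (bshift g))"
      by (simp add: h2inner_self H2_bshift g norm_power)
    also have "\<dots> \<le> hnorm (shiftz (bshift g)) * hnorm g"
      by (simp only: h2inner_bshift_right H2_bshift g norm_h2inner_le H2_shiftz)
    also have "\<dots> = hnorm (bshift g) * hnorm g" by (simp add: hnorm_shiftz H2_bshift g)
    finally show ?thesis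
      using hnorm_nonneg[OF H2_bshift[OF g]] hnorm_nonneg[OF g]
      by (cases "hnorm (bshift g) = 0") (auto simp: power2_eq_square)
  qed
  from this[OF H2_bshift_power[OF assms], of j] Suc.IH show ?case by simp
qed simp

lemma cinner_sums:
  assumes "f \<in> H2" "norm \<mu> < 1"
  shows "(\<lambda>j. cnj \<mu> ^ j * cinner w (hcoeff f j)) sums cinner w (f \<mu>)"
proof -
  have "(\<lambda>j. w $ i * cnj (hcoeff f j $ i * \<mu> ^ j)) sums (w $ i * cnj (f \<mu> $ i))" for i
    by (intro sums_mult hol_vec_sums[THEN iffD2[OF sums_cnj]] H2_hol_vec assms)
  from sums_sum[of UNIV, OF this] show ?thesis
    by (simp add: cinner_def sum_distrib_left mult_ac)
qed

lemma
  assumes h: "h \<in> H2" and \<zeta>: "norm \<zeta> > 1"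
  defines "e \<equiv> \<lambda>z. cscale (1 / (\<zeta> - z)) (h z)"
  shows resolvent_H2: "e \<in> H2"
    and resolvent_eq: "\<And>z. cscale \<zeta> (e z) = shiftz e z + h z"
proof -
  have ne: "\<zeta> - z \<noteq> 0" if "norm z < 1" for z using that \<zeta> by auto
  have out: "h z = 0" if "z \<notin> ball 0 1" for z using h that by (simp add: H2_iff)
  show "e \<in> H2"
  proof (rule dominated_H2(1)[OF _ _ h])
    show "hol_vec e"
      using h ne unfolding hol_vec_def H2_iff e_def cscale_def
      by (auto intro!: holomorphic_intros)
    show "e z = 0" if "z \<notin> ball 0 1" for z using out[OF that] by (simp add: e_def)
    show "norm (e z) \<le> 1 / (norm \<zeta> - 1) * norm (h z)" if "z \<in> ball 0 1" for z
    proof -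
      have "norm \<zeta> - 1 \<le> norm (\<zeta> - z)"
        using that norm_triangle_ineq2[of \<zeta> z] by simp
      hence "1 / norm (\<zeta> - z) \<le> 1 / (norm \<zeta> - 1)" using \<zeta> by (intro divide_left_mono mult_pos_pos) auto
      thus ?thesis unfolding e_def norm_cscale by (intro mult_right_mono) (simp_all add: norm_divide)
    qed
    show "0 \<le> 1 / (norm \<zeta> - 1)" using \<zeta> by simp
  qed
  show "cscale \<zeta> (e z) = shiftz e z + h z" for z
  proof (cases "norm z < 1")
    case True
    have "\<zeta> / (\<zeta> - z) = z / (\<zeta> - z) + 1" using ne[OF True] by (simp add: field_simps)
    thus ?thesis by (simp add: e_def shiftz_def cscale_cscale) (simp add: cscale_def vec_eq_iff algebra_simps)
  next
    case False
    thus ?thesis using out[of z] by (simp add: e_def shiftz_def)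
  qed
qed

context pure_inner
begin

lemma multop_shiftz_power: "multop \<Theta> ((shiftz ^^ j) f) = (shiftz ^^ j) (multop \<Theta> f)"
  by (induction j) (simp_all add: multop_shiftz)

lemma H2_shiftz_power: "f \<in> H2 \<Longrightarrow> (shiftz ^^ j) f \<in> H2"
  by (induction j) (auto intro: H2_shiftz)

text \<open>Up to a scalar this is the reproducing kernel at \<mu> = 1 / cnj \<zeta>. Expanding in
  powers of 1 / \<zeta>, its pairing with \<open>q = \<Theta> g\<close> becomes
  \<open>(cinner w (q \<mu>) - cinner d (g \<mu>)) / \<zeta>\<close>, and \<open>d\<close> is chosen
  to make this 0.\<close>

lemma resolvent_in_KTheta:
  fixes w :: "complex^'n"
  assumes \<zeta>: "norm \<zeta> > 1"
  defines "d \<equiv> adj (\<Theta> (1 / cnj \<zeta>)) *v w"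
  defines "h \<equiv> \<lambda>z. disc_const w z - \<Theta>c d z"
  shows "(\<lambda>z. cscale (1 / (\<zeta> - z)) (h z)) \<in> KTheta \<Theta>"
proof -
  define e where "e = (\<lambda>z. cscale (1 / (\<zeta> - z)) (h z))"
  have h: "h \<in> H2" unfolding h_def by (intro H2_intros \<Theta>c_H2)
  have e: "e \<in> H2" unfolding e_def by (rule resolvent_H2[OF h \<zeta>])
  have ne: "\<zeta> \<noteq> 0" using \<zeta> by auto
  \<comment> \<open>Pairs the resolvent equation \<open>\<zeta> e = z e + h\<close> with
    \<open>q\<close> and moves \<open>z\<close> over as a backward shift. Iterating it gives the
    expansion.\<close>
  have step: "h2inner e q = (h2inner h q + h2inner e (bshift q)) / \<zeta>" if q: "q \<in> H2" for q
  proof -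
    have "(\<lambda>z. cscale \<zeta> (e z)) = (\<lambda>z. shiftz e z + h z)"
      using resolvent_eq[OF h \<zeta>] by (simp add: e_def)
    hence "h2inner (\<lambda>z. cscale \<zeta> (e z)) q = h2inner (\<lambda>z. shiftz e z + h z) q" by simp
    thus ?thesis
      using ne by (simp add: h2inner_simps H2_intros e h q h2inner_bshift_right field_simps)
  qed
  have "h2inner e (multop \<Theta> g) = 0" if g: "g \<in> H2" for g
  proof -
    let ?q = "multop \<Theta> g"
    let ?\<mu> = "1 / cnj \<zeta>"
    have q: "?q \<in> H2" by (rule multop_H2[OF g])
    have \<mu>: "norm ?\<mu> < 1" using \<zeta> by (simp add: norm_divide divide_simps)
    \<comment> \<open>The term with \<open>d\<close> loses \<Theta> because powers of
      \<open>z\<close> commute with \<Theta> and multiplication by \<Theta> is isometric.\<close>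
    have a: "h2inner h ((bshift ^^ j) ?q) = cinner w (hcoeff ?q j) - cinner d (hcoeff g j)" for j
    proof -
      have "h2inner (\<Theta>c d) ((bshift ^^ j) ?q) = h2inner (multop \<Theta> ((shiftz ^^ j) (disc_const d))) ?q"
        by (simp add: h2inner_bshift_power \<Theta>c_H2 q multop_shiftz_power)
      also have "\<dots> = h2inner (disc_const d) ((bshift ^^ j) g)"
        by (simp add: multop_isometry H2_shiftz_power H2_disc_const g h2inner_bshift_power)
      finally show ?thesis
        by (simp add: h_def h2inner_simps H2_intros \<Theta>c_H2 H2_bshift_power q h2inner_disc_const_left
            bshift_power_0 g)
    qed
    have iter: "h2inner e ?q = (\<Sum>j<n. (1/\<zeta>) ^ Suc j * h2inner h ((bshift ^^ j) ?q)) + (1/\<zeta>) ^ n * h2inner e ((bshift ^^ n) ?q)" for n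
    proof (induction n)
      case (Suc n)
      have "h2inner e ((bshift ^^ n) ?q) = (h2inner h ((bshift ^^ n) ?q) + h2inner e ((bshift ^^ Suc n) ?q)) / \<zeta>"
        using step[OF H2_bshift_power[OF q], of n] by simp
      thus ?case by (subst Suc.IH) (simp add: field_simps add_divide_distrib)
    qed simp
    \<comment> \<open>The remainder vanishes since 1 / \<zeta> has modulus below 1 and the backward
      shifts are contractions.\<close>
    have "(\<lambda>n. (1/\<zeta>) ^ n * h2inner e ((bshift ^^ n) ?q)) \<longlonglongrightarrow> 0"
    proof (rule Lim_null_comparison)
      show "\<forall>\<^sub>F n in sequentially. norm ((1/\<zeta>) ^ n * h2inner e ((bshift ^^ n) ?q)) \<le> norm (1/\<zeta>) ^ n * (hnorm e * hnorm ?q)"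
      proof (intro always_eventually allI)
        fix n
        have "norm (h2inner e ((bshift ^^ n) ?q)) \<le> hnorm e * hnorm ?q"
          by (rule order_trans[OF norm_h2inner_le[OF e H2_bshift_power[OF q]]])
             (intro mult_left_mono hnorm_bshift_power_le q hnorm_nonneg e)
        thus "norm ((1/\<zeta>) ^ n * h2inner e ((bshift ^^ n) ?q)) \<le> norm (1/\<zeta>) ^ n * (hnorm e * hnorm ?q)"
          unfolding norm_mult norm_power by (intro mult_left_mono) auto
      qed
      have "(\<lambda>n. norm (1/\<zeta>) ^ n * (hnorm e * hnorm ?q)) \<longlonglongrightarrow> 0 * (hnorm e * hnorm ?q)"
        using \<zeta> by (intro tendsto_intros LIMSEQ_power_zero) (simp add: norm_divide divide_simps)
      thus "(\<lambda>n. norm (1/\<zeta>) ^ n * (hnorm e * hnorm ?q)) \<longlonglongrightarrow> 0" by simp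
    qed
    hence "(\<lambda>n. h2inner e ?q - (1/\<zeta>) ^ n * h2inner e ((bshift ^^ n) ?q)) \<longlonglongrightarrow> h2inner e ?q - 0"
      by (intro tendsto_intros)
    moreover have "h2inner e ?q - (1/\<zeta>) ^ n * h2inner e ((bshift ^^ n) ?q) =
        (\<Sum>j<n. (1/\<zeta>) ^ Suc j * h2inner h ((bshift ^^ j) ?q))" for n
      unfolding diff_eq_eq by (rule iter)
    ultimately have "(\<lambda>n. \<Sum>j<n. (1/\<zeta>) ^ Suc j * h2inner h ((bshift ^^ j) ?q)) \<longlonglongrightarrow> h2inner e ?q"
      by (simp only: diff_zero)
    hence 1: "(\<lambda>j. (1/\<zeta>) ^ Suc j * h2inner h ((bshift ^^ j) ?q)) sums h2inner e ?q"
      by (simp add: sums_def)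
    \<comment> \<open>As \<open>cnj \<mu> = 1 / \<zeta>\<close>, the series reassembles the Taylor
      expansions of \<open>q\<close> and \<open>g\<close> at \<mu>.\<close>
    have "(\<lambda>j. (1/\<zeta>) * (cnj ?\<mu> ^ j * cinner w (hcoeff ?q j) - cnj ?\<mu> ^ j * cinner d (hcoeff g j)))
        sums ((1/\<zeta>) * (cinner w (?q ?\<mu>) - cinner d (g ?\<mu>)))"
      by (intro sums_mult sums_diff cinner_sums q g \<mu>)
    moreover have "cinner w (?q ?\<mu>) = cinner d (g ?\<mu>)"
      by (simp add: multop_def d_def cinner_adj')
    ultimately have 2: "(\<lambda>j. (1/\<zeta>) ^ Suc j * h2inner h ((bshift ^^ j) ?q)) sums 0"
      by (simp add: a algebra_simps)
    show ?thesis using sums_unique2[OF 1 2] .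
  qed
  hence "e \<in> KTheta \<Theta>" using e by (simp add: KTheta_def)
  thus ?thesis by (simp add: e_def)
qed

text \<open>If \<open>\<delta> = 0\<close>, then \<open>E = model e v\<close> is an eigenvector of the dilation with eigenvalue \<open>b\<close>, and \<open>model f v\<close>
  differs from it by an element \<open>k\<close> of the model space. Since the dilation is isometric, the cross terms
  combine to \<open>b\<close> times a real number.\<close>

lemma quadratic_form_estimate:
  fixes u b \<zeta> :: complex and v w d :: "complex^'n"
  assumes f: "f \<in> KTheta \<Theta>" and e: "e \<in> KTheta \<Theta>"
    and eq: "\<And>z. cscale \<zeta> (e z) = shiftz e z + (disc_const w z - \<Theta>c d z)"
    and b: "norm b = 1" and u: "norm u = 1"
    and bound: "\<And>k. k \<in> KTheta \<Theta> \<Longrightarrow> Re (cnj u * h2inner (shiftz k) k) \<le> c * (hnorm k)\<^sup>2"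
    and c: "c \<le> Re (cnj u * b)"
  defines "\<delta> \<equiv> \<lambda>z. cscale (\<zeta> - b) (e z) + \<Theta>c (d - cscale b v) z"
  shows "Re (cnj u * h2inner (pert_shift f w) (model f v)) \<le>
    Re (cnj u * b) * (hnorm (model f v))\<^sup>2 + hnorm \<delta> * (hnorm (model f v) + hnorm (\<lambda>z. f z - e z))"
proof -
  note fH = KTheta_H2[OF f] and eH = KTheta_H2[OF e]
  define k where "k = (\<lambda>z. f z - e z)"
  have k: "k \<in> KTheta \<Theta>" unfolding k_def by (rule KTheta_diff[OF f e])
  define E where "E = model e v"
  have EH: "E \<in> H2" unfolding E_def by (rule H2_model[OF eH])
  define g where "g = model f v"
  have gH: "g \<in> H2" unfolding g_def by (rule H2_model[OF fH])
  have \<delta>H: "\<delta> \<in> H2" unfolding \<delta>_def by (intro H2_intros \<Theta>c_H2 eH)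
  note I = H2_intros \<Theta>c_H2 fH eH EH gH \<delta>H KTheta_H2[OF k]
  have g: "g = (\<lambda>z. k z + E z)" by (simp add: g_def E_def k_def model_def fun_eq_iff)
  have \<Theta>cd: "\<Theta>c (d - cscale b v) z = \<Theta>c d z - cscale b (\<Theta>c v z)" for z
    by (simp add: multop_def disc_const_def matrix_vector_mult_diff_distrib matrix_vector_mult_cscale)
  have E1: "(\<lambda>z. shiftz e z + disc_const w z) = (\<lambda>z. cscale b (E z) + \<delta> z)"
  proof
    fix z
    have "shiftz e z + disc_const w z = cscale \<zeta> (e z) + \<Theta>c d z" by (simp add: eq)
    also have "\<dots> = cscale b (E z) + \<delta> z"
      by (simp add: \<delta>_def \<Theta>cd E_def model_def cscale_right_distrib cscale_left_diff)
    finally show "shiftz e z + disc_const w z = cscale b (E z) + \<delta> z" .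
  qed
  have pert: "pert_shift f w = (\<lambda>z. shiftz k z + (cscale b (E z) + \<delta> z))"
  proof
    fix z
    have "pert_shift f w z = shiftz k z + (shiftz e z + disc_const w z)"
      by (simp add: pert_shift_def shiftz_def k_def cscale_right_diff)
    thus "pert_shift f w z = shiftz k z + (cscale b (E z) + \<delta> z)" using fun_cong[OF E1, of z] by simp
  qed
  \<comment> \<open>The isometry property for \<open>k\<close> and \<open>e\<close>: shifting both
    preserves the pairing, and \<open>z k\<close> is orthogonal to constants. On the other side
    \<open>k\<close> does not see the part \<open>\<Theta> v\<close> of \<open>E\<close>.\<close>
  have "cnj b * h2inner (shiftz k) E + h2inner (shiftz k) \<delta> = h2inner (shiftz k) (\<lambda>z. shiftz e z + disc_const w z)"
    unfolding E1 by (simp add: h2inner_simps I)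
  also have "\<dots> = h2inner k e"
    by (simp add: h2inner_simps I h2inner_shiftz_shiftz h2inner_shiftz_disc_const)
  also have "\<dots> = h2inner k E"
    unfolding E_def model_def by (simp add: h2inner_simps I KTheta_orth[OF k H2_disc_const])
  finally have "b * (cnj b * h2inner (shiftz k) E + h2inner (shiftz k) \<delta>) = b * h2inner k E" by simp
  moreover have "b * cnj b = 1" using complex_norm_square[of b] b by simp
  ultimately have cross: "h2inner (shiftz k) E = b * h2inner k E - b * h2inner (shiftz k) \<delta>"
    by (simp add: algebra_simps flip: mult.assoc)
  define err where "err = h2inner \<delta> g - b * h2inner (shiftz k) \<delta>"
  have kE: "h2inner k E + h2inner E k + h2inner E E = of_real ((hnorm g)\<^sup>2 - (hnorm k)\<^sup>2)"
  proof -
    have "complex_of_real ((hnorm g)\<^sup>2) = h2inner k k + h2inner k E + h2inner E k + h2inner E E"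
      by (subst h2inner_self[OF gH, symmetric]) (simp add: g h2inner_simps I algebra_simps)
    thus ?thesis by (simp add: h2inner_self I algebra_simps)
  qed
  have "h2inner (pert_shift f w) g = h2inner (shiftz k) k + h2inner (shiftz k) E + b * (h2inner E k + h2inner E E) + h2inner \<delta> g"
    by (simp add: pert g h2inner_simps I algebra_simps)
  also have "\<dots> = h2inner (shiftz k) k + b * (h2inner k E + h2inner E k + h2inner E E) + err"
    by (simp add: cross err_def algebra_simps)
  finally have "Re (cnj u * h2inner (pert_shift f w) g) = Re (cnj u * h2inner (shiftz k) k)
      + Re (cnj u * b) * ((hnorm g)\<^sup>2 - (hnorm k)\<^sup>2) + Re (cnj u * err)"
    by (simp only: kE) (simp add: algebra_simps)
  also have "\<dots> \<le> c * (hnorm k)\<^sup>2 + Re (cnj u * b) * ((hnorm g)\<^sup>2 - (hnorm k)\<^sup>2) + norm err"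
    using bound[OF k] complex_Re_le_cmod[of "cnj u * err"] u by (simp add: norm_mult)
  \<comment> \<open>The \<open>k\<close> terms drop out because \<open>c\<close> is at most the
    coefficient with which the squared norm of \<open>k\<close> is subtracted.\<close>
  also have "\<dots> \<le> Re (cnj u * b) * (hnorm g)\<^sup>2 + norm err"
    using mult_right_mono[OF c, of "(hnorm k)\<^sup>2"] by (simp add: right_diff_distrib)
  also have "norm err \<le> hnorm \<delta> * hnorm g + hnorm (shiftz k) * hnorm \<delta>"
    unfolding err_def using norm_h2inner_le[OF \<delta>H gH] norm_h2inner_le[OF H2_shiftz[OF KTheta_H2[OF k]] \<delta>H] b
    by (intro order_trans[OF norm_triangle_ineq4] add_mono) (simp_all add: norm_mult)
  finally show ?thesis
    by (simp add: hnorm_shiftz I g_def[symmetric]) (simp add: k_def algebra_simps)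
qed

text \<open>The usual resolvent bound outside the numerical range: pair the equation with
  \<open>e\<close>, which removes the \<Theta> term, and take real parts after multiplying by
  \<open>cnj u\<close>. The separate constant \<kappa> makes the bound uniform over all \<zeta> that
  keep this distance.\<close>

lemma resolvent_bound:
  assumes e: "e \<in> KTheta \<Theta>" and eq: "\<And>z. cscale \<zeta> (e z) = shiftz e z + (disc_const w z - \<Theta>c d z)"
    and u: "norm u = 1"
    and bound: "\<And>k. k \<in> KTheta \<Theta> \<Longrightarrow> Re (cnj u * h2inner (shiftz k) k) \<le> c * (hnorm k)\<^sup>2"
    and \<kappa>: "\<kappa> > 0" "\<kappa> \<le> Re (cnj u * \<zeta>) - c"
  shows "hnorm e \<le> norm w / \<kappa>"
proof -
  note I = H2_intros \<Theta>c_H2 KTheta_H2[OF e]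
  have "(\<lambda>z. cscale \<zeta> (e z)) = (\<lambda>z. shiftz e z + (disc_const w z - \<Theta>c d z))" by (simp add: eq)
  hence "h2inner (\<lambda>z. cscale \<zeta> (e z)) e = h2inner (\<lambda>z. shiftz e z + (disc_const w z - \<Theta>c d z)) e" by simp
  hence "\<zeta> * of_real ((hnorm e)\<^sup>2) = h2inner (shiftz e) e + h2inner (disc_const w) e"
    by (simp add: h2inner_simps I KTheta_orth[OF e H2_disc_const] h2inner_self)
  from arg_cong[OF this, of "(*) (cnj u)"]
  have "cnj u * \<zeta> * of_real ((hnorm e)\<^sup>2) = cnj u * h2inner (shiftz e) e + cnj u * h2inner (disc_const w) e"
    by (simp only: distrib_left mult.assoc)
  hence "Re (cnj u * \<zeta> * of_real ((hnorm e)\<^sup>2)) = Re (cnj u * h2inner (shiftz e) e) + Re (cnj u * h2inner (disc_const w) e)"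
    by simp
  hence "Re (cnj u * \<zeta>) * (hnorm e)\<^sup>2 = Re (cnj u * h2inner (shiftz e) e) + Re (cnj u * h2inner (disc_const w) e)"
    by (simp only: Re_complex_of_real times_complex.sel Im_complex_of_real mult_zero_right diff_zero)
  moreover have "Re (cnj u * h2inner (disc_const w) e) \<le> norm w * hnorm e"
    using complex_Re_le_cmod[of "cnj u * h2inner (disc_const w) e"] norm_h2inner_le[OF H2_disc_const, of e w] I u
    by (simp add: norm_mult hnorm_disc_const)
  ultimately have "(Re (cnj u * \<zeta>) - c) * (hnorm e)\<^sup>2 \<le> norm w * hnorm e"
    using bound[OF e] by (simp add: left_diff_distrib)
  moreover have "\<kappa> * (hnorm e)\<^sup>2 \<le> (Re (cnj u * \<zeta>) - c) * (hnorm e)\<^sup>2"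
    by (intro mult_right_mono \<kappa>) simp
  ultimately have "\<kappa> * hnorm e * hnorm e \<le> norm w * hnorm e" by (simp add: power2_eq_square mult_ac)
  hence "\<kappa> * hnorm e \<le> norm w"
    using hnorm_nonneg[OF KTheta_H2[OF e]] by (cases "hnorm e = 0") auto
  thus ?thesis using \<kappa> by (simp add: field_simps)
qed

end

section \<open>Wrapping\<close>

lemma hausdorff_dist_closure_le:
  assumes ne: "A \<noteq> {}" "B \<noteq> {}"
    and AB: "\<And>a. a \<in> A \<Longrightarrow> \<exists>b\<in>B. dist a b \<le> \<epsilon>" and BA: "\<And>b. b \<in> B \<Longrightarrow> \<exists>a\<in>A. dist b a \<le> \<epsilon>"
  shows "hausdorff_dist (closure A) (closure B) \<le> \<epsilon>"
proof -
  have *: "(SUP x\<in>closure X. infdist x (closure Y)) \<le> \<epsilon>"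
    if "X \<noteq> {}" "Y \<noteq> {}" and XY: "\<And>x. x \<in> X \<Longrightarrow> \<exists>y\<in>Y. dist x y \<le> \<epsilon>" for X Y :: "complex set"
  proof (rule cSUP_least)
    show "closure X \<noteq> {}" using that by simp
    fix x assume x: "x \<in> closure X"
    \<comment> \<open>Being within \<epsilon> of \<open>Y\<close> is a closed condition, so an
      estimate on \<open>X\<close> extends to its closure.\<close>
    have "closed {x. infdist x Y \<le> \<epsilon>}" by (intro closed_Collect_le continuous_intros)
    moreover have "X \<subseteq> {x. infdist x Y \<le> \<epsilon>}"
      using XY by (auto intro: infdist_le2)
    ultimately have "infdist x Y \<le> \<epsilon>" using closure_minimal x by blast
    moreover have "infdist x (closure Y) \<le> infdist x Y"
      using that by (intro infdist_mono closure_subset)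
    ultimately show "infdist x (closure Y) \<le> \<epsilon>" by linarith
  qed
  show ?thesis unfolding hausdorff_dist_def using *[OF ne AB] *[OF ne(2,1) BA] by simp
qed

lemma unitary_norm:
  assumes "unitary U" shows "norm (U *v x) = norm x"
proof -
  have "cinner (U *v x) (U *v x) = cinner x x"
    using assms by (simp add: cinner_adj' matrix_vector_mul_assoc unitary_def)
  thus ?thesis unfolding cinner_self by (simp add: power2_eq_iff_nonneg del: of_real_power)
qed

lemma hnorm_triangle_diff:
  assumes "f \<in> H2" "g \<in> H2"
  shows "hnorm (\<lambda>z. f z - g z) \<le> hnorm f + hnorm g"
proof -
  have "(\<lambda>z. f z + cscale (-1) (g z)) = (\<lambda>z. f z - g z)"
    by (simp add: cscale_def vec_eq_iff fun_eq_iff)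
  thus ?thesis using hnorm_triangle[of f "\<lambda>z. cscale (-1) (g z)"] assms
    by (simp add: H2_cscale hnorm_cscale)
qed

text \<open>A nonempty open set of angles is not null, so a property valid almost everywhere holds
  at one of them. The bounds on \<open>c0\<close> and \<open>c1\<close> ensure that the strip meets
  the unit circle.\<close>

lemma ex_angle_in_halfplane_strip:
  assumes AE: "AE t in circ_measure. P t" and u: "norm u = 1" and m: "-1 \<le> c0" "c0 < c1" "c1 \<le> 1"
  shows "\<exists>t. P t \<and> c0 < Re (cnj u * cis t) \<and> Re (cnj u * cis t) < c1"
proof (rule ccontr)
  assume no: "\<not> ?thesis"
  define S where "S = {t. c0 < Re (cnj u * cis t) \<and> Re (cnj u * cis t) < c1}"
  have S: "open S"
    unfolding S_def by (intro open_Collect_conj open_Collect_less continuous_intros)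
  define c where "c = (c0 + c1) / 2"
  have c: "c0 < c" "c < c1" "-1 \<le> c" "c \<le> 1" using m by (auto simp: c_def)
  define z where "z = u * cis (arccos c)"
  have z: "norm z = 1" by (simp add: z_def u norm_mult)
  have "cnj u * z = cis (arccos c)"
    using complex_norm_square[of u] u by (simp add: z_def mult.commute flip: mult.assoc)
  hence Re: "Re (cnj u * z) = c" using c by simp
  have zc: "cis (Arg2pi z) = z" using Arg2pi_eq[of z] z by (simp add: cis_conv_exp)
  have "Arg2pi z \<in> S" unfolding S_def mem_Collect_eq zc Re using c by blast
  \<comment> \<open>The angle may be the endpoint 0. Membership in the closure of the open interval
    still gives a point of the open set \<open>S\<close> inside the interval.\<close>
  moreover have "Arg2pi z \<in> closure {0<..<2*pi}" using Arg2pi[of z] by simp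
  ultimately have ne: "S \<inter> {0<..<2*pi} \<noteq> {}"
    using open_Int_closure_eq_empty[OF S] by blast
  have op: "open (S \<inter> {0<..<2*pi})" using S by auto
  have "AE t in lebesgue. t \<in> {0..2*pi} \<longrightarrow> P t"
    using AE by (subst (asm) AE_restrict_space_iff) auto
  hence "AE t in lebesgue. t \<notin> S \<inter> {0<..<2*pi}"
    by (rule AE_mp) (use no in \<open>auto simp: S_def\<close>)
  hence "negligible (S \<inter> {0<..<2*pi})"
    using op by (subst (asm) AE_iff_null_sets[symmetric]) (auto simp: negligible_iff_null_sets)
  thus False using open_not_negligible[OF op ne] by contradiction
qed

section \<open>Numerical ranges of the dilations and the choice of \<Omega>\<close>

context pure_inner
begin

lemma form_bound_of_radial_limit:
  fixes u :: complex and t :: real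
  defines "b \<equiv> cis t"
  assumes lim: "((\<lambda>r. \<Theta> (complex_of_real r * b)) \<longlongrightarrow> L) (at_left 1)" and L: "isometry_mat L"
    and u: "norm u = 1"
    and bound: "\<And>k. k \<in> KTheta \<Theta> \<Longrightarrow> Re (cnj u * h2inner (shiftz k) k) \<le> c * (hnorm k)\<^sup>2"
    and c: "c < Re (cnj u * b)" and f: "f \<in> KTheta \<Theta>"
  shows "Re (cnj u * h2inner (pert_shift f (cscale b (L *v v))) (model f v)) \<le>
    Re (cnj u * b) * (hnorm (model f v))\<^sup>2"
proof -
  have b: "norm b = 1" "b * cnj b = 1" by (auto simp: b_def cis_cnj cis_mult)
  define w where "w = cscale b (L *v v)"
  \<comment> \<open>The index starts at 1 because \<open>radii 0 = 0\<close>, and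
    \<open>b / r n\<close> requires a positive radius.\<close>
  define r where "r n = radii (Suc n)" for n
  have r: "0 < r n" "r n < 1" for n
    using radii_bounds(2)[of "Suc n"] by (auto simp: r_def radii_def field_simps)
  have rlim: "filterlim r (at_left 1) sequentially"
    unfolding r_def by (rule filterlim_compose[OF radii_at_left filterlim_Suc])
  define \<zeta> where "\<zeta> n = b / complex_of_real (r n)" for n
  have \<zeta>1: "norm (\<zeta> n) > 1" for n using r[of n] b by (simp add: \<zeta>_def norm_divide)
  have \<zeta>inv: "1 / cnj (\<zeta> n) = complex_of_real (r n) * b" for n
  proof -
    have "cnj b \<noteq> 0" using b(2) by auto
    thus ?thesis using r[of n] b(2) by (simp add: \<zeta>_def field_simps)
  qed
  have \<zeta>lim: "\<zeta> \<longlonglongrightarrow> b"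
  proof -
    have "r \<longlonglongrightarrow> 1" using rlim by (simp add: filterlim_at)
    hence "(\<lambda>n. b / complex_of_real (r n)) \<longlonglongrightarrow> b / complex_of_real 1" by (intro tendsto_intros) auto
    thus ?thesis by (simp add: \<zeta>_def[abs_def])
  qed
  define d where "d n = adj (\<Theta> (1 / cnj (\<zeta> n))) *v w" for n
  \<comment> \<open>This is where \<open>\<Omega> = b L\<close> pays off: since
    \<open>adj L ** L = mat 1\<close>, the limit of \<open>d\<close> is \<open>b v\<close>, so the
    second part of \<open>\<delta>\<close> tends to 0.\<close>
  have dlim: "d \<longlonglongrightarrow> cscale b v"
  proof -
    have "(\<lambda>n. \<Theta> (complex_of_real (r n) * b)) \<longlonglongrightarrow> L" by (rule filterlim_compose[OF lim rlim])
    hence "(\<lambda>n. adj (\<Theta> (1 / cnj (\<zeta> n)))) \<longlonglongrightarrow> adj L"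
      unfolding \<zeta>inv adj_def by (intro tendsto_vec_lambda tendsto_cnj tendsto_vec_nth)
    hence "d \<longlonglongrightarrow> adj L *v w"
      unfolding d_def by (intro tendsto_matrix_vector_mult tendsto_const)
    also have "adj L *v w = cscale b v"
      using isometry_mat_adj_mult[OF L] by (simp add: w_def matrix_vector_mult_cscale matrix_vector_mul_assoc)
    finally show ?thesis .
  qed
  define e where "e n = (\<lambda>z. cscale (1 / (\<zeta> n - z)) (disc_const w z - \<Theta>c (d n) z))" for n
  have eK: "e n \<in> KTheta \<Theta>" for n
    unfolding e_def d_def by (rule resolvent_in_KTheta[OF \<zeta>1])
  have eeq: "cscale (\<zeta> n) (e n z) = shiftz (e n) z + (disc_const w z - \<Theta>c (d n) z)" for n z
    unfolding e_def by (rule resolvent_eq[OF _ \<zeta>1]) (intro H2_intros \<Theta>c_H2)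
  define \<delta> where "\<delta> n = (\<lambda>z. cscale (\<zeta> n - b) (e n z) + \<Theta>c (d n - cscale b v) z)" for n
  \<comment> \<open>Half of the gap between \<open>b\<close> and the numerical range, so that for
    large \<open>n\<close> the points \<open>\<zeta> n\<close> still keep the distance
    \<kappa>.\<close>
  define \<kappa> where "\<kappa> = (Re (cnj u * b) - c) / 2"
  have gap: "0 < (x - c) / 2" "(x - c) / 2 < x - c" if "c < x" for x using that by auto
  have \<kappa>: "\<kappa> > 0" unfolding \<kappa>_def by (rule gap(1)[OF c])
  define R where "R = norm w / \<kappa>"
  \<comment> \<open>Bounds the norm of \<open>\<delta> n\<close> once the kernels are bounded by
    \<open>R\<close>, and tends to 0 without any convergence of the kernels.\<close>
  define \<eta> where "\<eta> n = norm (\<zeta> n - b) * R + norm (d n - cscale b v)" for n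
  let ?X = "Re (cnj u * h2inner (pert_shift f w) (model f v))" and ?G = "hnorm (model f v)"
  have G: "?G \<ge> 0" by (intro hnorm_nonneg H2_model KTheta_H2 f)
  have "(\<lambda>n. Re (cnj u * \<zeta> n) - c) \<longlonglongrightarrow> Re (cnj u * b) - c"
    by (intro tendsto_intros \<zeta>lim)
  moreover have "\<kappa> < Re (cnj u * b) - c" unfolding \<kappa>_def by (rule gap(2)[OF c])
  ultimately have "eventually (\<lambda>n. \<kappa> < Re (cnj u * \<zeta> n) - c) sequentially"
    by (rule order_tendstoD)
  hence ev: "eventually (\<lambda>n. ?X \<le> Re (cnj u * b) * ?G\<^sup>2 + \<eta> n * (?G + (hnorm f + R))) sequentially"
  proof eventually_elim
    case (elim n)
    have eR: "hnorm (e n) \<le> R"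
      unfolding R_def by (rule resolvent_bound[OF eK eeq u bound \<kappa> less_imp_le[OF elim]])
    have \<delta>\<eta>: "hnorm (\<delta> n) \<le> \<eta> n"
    proof -
      have "hnorm (\<delta> n) \<le> norm (\<zeta> n - b) * hnorm (e n) + norm (d n - cscale b v)"
        unfolding \<delta>_def using hnorm_triangle[OF H2_cscale[OF KTheta_H2[OF eK]] \<Theta>c_H2]
        by (simp add: hnorm_cscale KTheta_H2 eK hnorm_multop[OF inner] H2_disc_const hnorm_disc_const)
      also have "\<dots> \<le> \<eta> n" unfolding \<eta>_def by (intro add_mono mult_left_mono eR) auto
      finally show ?thesis .
    qed
    have "?X \<le> Re (cnj u * b) * ?G\<^sup>2 + hnorm (\<delta> n) * (?G + hnorm (\<lambda>z. f z - e n z))"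
      unfolding \<delta>_def by (rule quadratic_form_estimate[OF f eK eeq b(1) u bound less_imp_le[OF c]])
    also have "hnorm (\<delta> n) * (?G + hnorm (\<lambda>z. f z - e n z)) \<le> \<eta> n * (?G + (hnorm f + R))"
    proof (intro mult_mono \<delta>\<eta> add_left_mono)
      show "hnorm (\<lambda>z. f z - e n z) \<le> hnorm f + R"
        using hnorm_triangle_diff[OF KTheta_H2[OF f] KTheta_H2[OF eK[of n]]] eR by simp
      show "0 \<le> \<eta> n" unfolding \<eta>_def R_def using \<kappa> by simp
      show "0 \<le> ?G + hnorm (\<lambda>z. f z - e n z)"
        using G hnorm_nonneg[OF H2_diff[OF KTheta_H2[OF f] KTheta_H2[OF eK[of n]]]] by simp
    qed
    finally show ?case by simp
  qed
  have "(\<lambda>n. Re (cnj u * b) * ?G\<^sup>2 + \<eta> n * (?G + (hnorm f + R))) \<longlonglongrightarrow>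
     Re (cnj u * b) * ?G\<^sup>2 + (norm (b - b) * R + norm (cscale b v - cscale b v)) * (?G + (hnorm f + R))"
    unfolding \<eta>_def by (intro tendsto_intros \<zeta>lim dlim)
  from tendsto_lowerbound[OF this ev] show ?thesis by (simp add: w_def)
qed

lemma norm_form_le:
  assumes "unitary \<Omega>" "f \<in> KTheta \<Theta>" "(hnorm f)\<^sup>2 + (norm v)\<^sup>2 = 1"
  shows "norm (h2inner (pert_shift f (\<Omega> *v v)) (model f v)) \<le> 1"
proof -
  have "hnorm (pert_shift f (\<Omega> *v v)) = 1" "hnorm (model f v) = 1"
    using assms hnorm_pert_shift_sq[of f "\<Omega> *v v"] hnorm_model_sq[of f v]
      hnorm_nonneg[OF H2_model, of f v] hnorm_nonneg[OF H2_pert_shift, of f "\<Omega> *v v"]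
    by (auto simp: unitary_norm KTheta_H2 power2_eq_1_iff)
  thus ?thesis
    using norm_h2inner_le[OF H2_pert_shift[of f "\<Omega> *v v"] H2_model[of f v]] assms by (simp add: KTheta_H2)
qed

lemma numrange_U_subset: "unitary \<Omega> \<Longrightarrow> numrange_U \<Theta> \<Omega> \<subseteq> cball 0 1"
  using norm_form_le by (auto simp: numrange_U_eq)

lemma numrange_U_nonempty: "numrange_U \<Theta> \<Omega> \<noteq> {}"
proof -
  obtain f where f: "f \<in> KTheta \<Theta>" "hnorm f = 1" using ex_unit_KTheta by blast
  hence "h2inner (pert_shift f (\<Omega> *v 0)) (model f 0) \<in> numrange_U \<Theta> \<Omega>"
    unfolding numrange_U_eq by (intro CollectI exI[of _ f] exI[of _ 0]) simp
  thus ?thesis by blast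
qed

lemma numrange_S_nonempty: "numrange_S \<Theta> \<noteq> {}"
  using ex_unit_KTheta by (auto simp: numrange_S_eq)

lemma numrange_S_subset: "numrange_S \<Theta> \<subseteq> cball 0 1"
  unfolding numrange_S_eq
proof safe
  fix f assume f: "f \<in> KTheta \<Theta>" "hnorm f = 1"
  have "norm (h2inner (shiftz f) f) \<le> 1"
    using norm_h2inner_le[of "shiftz f" f] f by (simp add: hnorm_shiftz KTheta_H2 H2_shiftz)
  thus "h2inner (shiftz f) f \<in> cball 0 1" by simp
qed

text \<open>Replacing \<Omega> changes \<open>pert_shift\<close> by a constant function, of norm at
  most the distance of the two matrices when \<open>v\<close> has norm at most 1. Values for the
  same \<open>f\<close> and \<open>v\<close> are therefore close.\<close>

lemma hausdorff_dist_numrange_U_le: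
  "hausdorff_dist (closure (numrange_U \<Theta> \<Omega>')) (closure (numrange_U \<Theta> \<Omega>)) \<le> dist \<Omega>' \<Omega>"
proof -
  have *: "dist (h2inner (pert_shift f (A *v v)) (model f v)) (h2inner (pert_shift f (B *v v)) (model f v)) \<le> dist A B"
    if f: "f \<in> KTheta \<Theta>" "(hnorm f)\<^sup>2 + (norm v)\<^sup>2 = 1" for f v A B
  proof -
    have G: "hnorm (model f v) = 1"
      using f hnorm_model_sq[of f v] hnorm_nonneg[OF H2_model, of f v]
      by (auto simp: KTheta_H2 power2_eq_1_iff)
    have v: "norm v \<le> 1"
    proof (rule power2_le_imp_le[where y = 1])
      show "(norm v)\<^sup>2 \<le> 1\<^sup>2" unfolding one_power2 using f(2) zero_le_power2[of "hnorm f"] by linarith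
    qed simp
    have "(\<lambda>z. pert_shift f (A *v v) z - pert_shift f (B *v v) z) = disc_const ((A - B) *v v)"
      by (simp add: fun_eq_iff pert_shift_def disc_const_def matrix_vector_mult_diff_rdistrib)
    hence "h2inner (pert_shift f (A *v v)) (model f v) - h2inner (pert_shift f (B *v v)) (model f v)
      = h2inner (disc_const ((A - B) *v v)) (model f v)"
      using f by (simp add: h2inner_diff_left[symmetric] H2_pert_shift H2_model KTheta_H2)
    also have "norm \<dots> \<le> norm ((A - B) *v v)"
      using norm_h2inner_le[OF H2_disc_const[of "(A - B) *v v"] H2_model[of f v]] f G
      by (simp add: KTheta_H2 hnorm_disc_const)
    also have "\<dots> \<le> norm (A - B) * norm v" by (rule norm_mat_vec_le)
    also have "\<dots> \<le> norm (A - B) * 1" by (intro mult_left_mono v) simp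
    finally show ?thesis by (simp add: dist_norm)
  qed
  show ?thesis
  proof (rule hausdorff_dist_closure_le)
    show "\<exists>b\<in>numrange_U \<Theta> \<Omega>. dist a b \<le> dist \<Omega>' \<Omega>" if "a \<in> numrange_U \<Theta> \<Omega>'" for a
      using that * unfolding numrange_U_eq by blast
    show "\<exists>a\<in>numrange_U \<Theta> \<Omega>'. dist b a \<le> dist \<Omega>' \<Omega>" if "b \<in> numrange_U \<Theta> \<Omega>" for b
      using that *[where A = \<Omega> and B = \<Omega>'] unfolding numrange_U_eq dist_commute[of \<Omega>' \<Omega>] by blast
  qed (rule numrange_U_nonempty)+
qed

lemma numrange_S_bound:
  assumes "\<And>z. z \<in> numrange_S \<Theta> \<Longrightarrow> Re (cnj u * z) \<le> c" and k: "k \<in> KTheta \<Theta>"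
  shows "Re (cnj u * h2inner (shiftz k) k) \<le> c * (hnorm k)\<^sup>2"
proof (cases "hnorm k = 0")
  case True
  have "norm (h2inner (shiftz k) k) \<le> hnorm (shiftz k) * hnorm k"
    by (intro norm_h2inner_le H2_intros KTheta_H2 k)
  thus ?thesis using True by simp
next
  case False
  note kH = KTheta_H2[OF k]
  define s where "s = 1 / hnorm k"
  define k1 where "k1 = (\<lambda>z. cscale (of_real s) (k z))"
  have "hnorm k1 = 1"
    using False hnorm_nonneg[OF kH] by (simp add: k1_def hnorm_cscale kH s_def norm_divide)
  hence "h2inner (shiftz k1) k1 \<in> numrange_S \<Theta>"
    using KTheta_cscale[OF k] unfolding numrange_S_eq k1_def by blast
  moreover have "h2inner (shiftz k1) k1 = of_real (s\<^sup>2) * h2inner (shiftz k) k"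
  proof -
    have "shiftz k1 = (\<lambda>z. cscale (of_real s) (shiftz k z))"
      by (simp add: shiftz_def k1_def cscale_cscale mult.commute)
    thus ?thesis by (simp add: k1_def h2inner_simps H2_intros kH power2_eq_square)
  qed
  ultimately have "Re (cnj u * (of_real (s\<^sup>2) * h2inner (shiftz k) k)) \<le> c"
    using assms(1) by metis
  also have "cnj u * (of_real (s\<^sup>2) * h2inner (shiftz k) k) = of_real (s\<^sup>2) * (cnj u * h2inner (shiftz k) k)"
    by (simp add: mult_ac)
  finally have "s\<^sup>2 * Re (cnj u * h2inner (shiftz k) k) \<le> c" by (simp only: Re_complex_of_real times_complex.sel Im_complex_of_real mult_zero_left diff_zero)
  thus ?thesis using False by (simp add: s_def field_simps)
qed

lemma ex_unitary_in_halfplane: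
  assumes u: "norm u = 1" and H: "closure (numrange_S \<Theta>) \<subseteq> {z. Re (cnj u * z) < c1}"
  shows "\<exists>\<Omega>. unitary \<Omega> \<and> closure (numrange_U \<Theta> \<Omega>) \<subseteq> {z. Re (cnj u * z) < c1}"
proof (cases "c1 > 1")
  case True
  \<comment> \<open>Here the half-plane contains the closed unit disc, so any unitary would do.
    Afterwards \<open>c1\<close> is at most 1, as the choice of an angle requires.\<close>
  have "unitary (mat 1 :: complex^'n^'n)" by (simp add: unitary_def)
  moreover have "closure (numrange_U \<Theta> (mat 1)) \<subseteq> {z. Re (cnj u * z) < c1}"
  proof
    fix z assume "z \<in> closure (numrange_U \<Theta> (mat 1))"
    hence "norm z \<le> 1"
      using closure_minimal[OF numrange_U_subset closed_cball] calculation by fastforce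
    thus "z \<in> {z. Re (cnj u * z) < c1}"
      using complex_Re_le_cmod[of "cnj u * z"] True u by (simp add: norm_mult)
  qed
  ultimately show ?thesis by blast
next
  case False
  let ?W = "closure (numrange_S \<Theta>)"
  have W1: "?W \<subseteq> cball 0 1" by (rule closure_minimal[OF numrange_S_subset closed_cball])
  hence "compact ?W" using bounded_subset[OF bounded_cball] by (simp add: compact_eq_bounded_closed)
  moreover have "?W \<noteq> {}" using numrange_S_nonempty by simp
  moreover have "continuous_on ?W (\<lambda>z. Re (cnj u * z))" by (intro continuous_intros)
  ultimately obtain z0 where z0: "z0 \<in> ?W" "\<And>z. z \<in> ?W \<Longrightarrow> Re (cnj u * z) \<le> Re (cnj u * z0)"
    using continuous_attains_sup[of ?W "\<lambda>z. Re (cnj u * z)"] by blast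
  \<comment> \<open>The supremum is attained on a compact set, which gives the strict inequality
    \<open>c0 < c1\<close> and thus room for \<open>b\<close> between the two lines.\<close>
  define c0 where "c0 = Re (cnj u * z0)"
  have "c0 < c1" using H z0(1) by (auto simp: c0_def)
  moreover have "-1 \<le> c0"
    using abs_Re_le_cmod[of "cnj u * z0"] z0(1) W1 u by (auto simp: c0_def norm_mult)
  moreover have bound: "Re (cnj u * h2inner (shiftz k) k) \<le> c0 * (hnorm k)\<^sup>2" if "k \<in> KTheta \<Theta>" for k
    using z0(2) closure_subset by (intro numrange_S_bound that) (auto simp: c0_def)
  moreover have "AE t in circ_measure. \<exists>L. ((\<lambda>r. \<Theta> (complex_of_real r * cis t)) \<longlongrightarrow> L) (at_left 1) \<and> isometry_mat L"
    using inner by (simp add: inner_fun_def)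
  ultimately obtain t L where t: "c0 < Re (cnj u * cis t)" "Re (cnj u * cis t) < c1"
    and L: "((\<lambda>r. \<Theta> (complex_of_real r * cis t)) \<longlongrightarrow> L) (at_left 1)" "isometry_mat L"
    using ex_angle_in_halfplane_strip[OF _ u, of _ c0 c1] False by force
  define \<Omega> where "\<Omega> = (\<chi> i j. cis t * L $ i $ j)"
  have \<Omega>: "\<Omega> *v v = cscale (cis t) (L *v v)" for v
    by (simp add: \<Omega>_def matrix_vector_mult_def cscale_def vec_eq_iff sum_distrib_left mult_ac)
  have "isometry_mat \<Omega>" using L(2) by (simp add: isometry_mat_def \<Omega> norm_cscale)
  hence "unitary \<Omega>" by (simp add: unitary_def isometry_mat_adj_mult)
  \<comment> \<open>The estimate has the closed half-plane through \<open>b\<close>, so it passes to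
    the closure, and \<open>b\<close> lies strictly below \<open>c1\<close>.\<close>
  moreover have "numrange_U \<Theta> \<Omega> \<subseteq> {z. Re (cnj u * z) \<le> Re (cnj u * cis t)}"
  proof
    fix z assume "z \<in> numrange_U \<Theta> \<Omega>"
    then obtain f v where z: "z = h2inner (pert_shift f (\<Omega> *v v)) (model f v)"
      and f: "f \<in> KTheta \<Theta>" "(hnorm f)\<^sup>2 + (norm v)\<^sup>2 = 1"
      by (auto simp: numrange_U_eq)
    show "z \<in> {z. Re (cnj u * z) \<le> Re (cnj u * cis t)}"
      using form_bound_of_radial_limit[OF L u bound t(1) f(1), of v] f by (simp add: z \<Omega> hnorm_model_sq)
  qed
  hence "closure (numrange_U \<Theta> \<Omega>) \<subseteq> {z. Re (cnj u * z) \<le> Re (cnj u * cis t)}"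
    by (intro closure_minimal closed_Collect_le continuous_intros)
  hence "closure (numrange_U \<Theta> \<Omega>) \<subseteq> {z. Re (cnj u * z) < c1}" using t(2) by force
  ultimately show ?thesis by blast
qed

end

theorem theorem4p6:
  fixes \<Theta> :: "complex \<Rightarrow> complex^'n::finite^'n"
  assumes "inner_fun \<Theta>" and "pure_fun \<Theta>"
  shows "wraps {\<Omega>. unitary \<Omega>} (\<lambda>\<Omega>. closure (numrange_U \<Theta> \<Omega>)) (closure (numrange_S \<Theta>))"
proof -
  interpret pure_inner \<Theta> using assms by unfold_locales
  show ?thesis
    unfolding wraps_def
  proof (intro conjI ballI allI impI)
    fix \<Omega> :: "complex^'n^'n" assume \<Omega>: "\<Omega> \<in> {\<Omega>. unitary \<Omega>}"
    have "bounded (numrange_U \<Theta> \<Omega>)" using bounded_subset[OF bounded_cball numrange_U_subset] \<Omega> by simp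
    thus "compact (closure (numrange_U \<Theta> \<Omega>))" by simp
    show "closure (numrange_U \<Theta> \<Omega>) \<noteq> {}" using numrange_U_nonempty by simp
    fix e :: real assume "e > 0"
    thus "\<exists>d>0. \<forall>\<Omega>'\<in>{\<Omega>. unitary \<Omega>}. dist \<Omega>' \<Omega> < d \<longrightarrow>
        hausdorff_dist (closure (numrange_U \<Theta> \<Omega>')) (closure (numrange_U \<Theta> \<Omega>)) < e"
      using hausdorff_dist_numrange_U_le order_le_less_trans by blast
  next
    fix H assume H: "open_halfplane H \<and> closure (numrange_S \<Theta>) \<subseteq> H"
    then obtain a c where a: "a \<noteq> 0" and Heq: "H = {z. Re (cnj a * z) < c}"
      by (auto simp: open_halfplane_def)
    define u where "u = a / of_real (norm a)"
    have u: "norm u = 1" using a by (simp add: u_def norm_divide)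
    have "Re (cnj a * z) = norm a * Re (cnj u * z)" for z
    proof -
      have "cnj a * z = of_real (norm a) * (cnj u * z)" using a by (simp add: u_def)
      thus ?thesis by (simp only: Re_complex_of_real times_complex.sel Im_complex_of_real mult_zero_left diff_zero)
    qed
    hence "H = {z. Re (cnj u * z) < c / norm a}" using a by (simp add: Heq field_simps)
    thus "\<exists>\<Omega>\<in>{\<Omega>. unitary \<Omega>}. closure (numrange_U \<Theta> \<Omega>) \<subseteq> H"
      using ex_unitary_in_halfplane[OF u, of "c / norm a"] H by simp
  qed
qed

end
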